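(* Suppose that $\omega$ is increasing. For any $\mu\ge 0$, define \[q_\mu(\theta)=D\big(c,\overline{J_\mu}(\theta)\big),\qquad J_\mu(\theta)=\theta+\frac{\mu\underline\theta\,\delta_{\underline\theta}(\theta)-\int_{\theta}^{\overline\theta}[\alpha-\omega(s)]\,dF(s)}{\alpha f(\theta)}.\] Let \[\theta_L^*=\min\left\{\theta\in[\underline\theta,\overline\theta]:\int_{\theta}^{\overline\theta}[\alpha-\omega(s)]\,dF(s)\le 0\right\}\] and $\mu^*=(\mathbf E[\omega]-\alpha)_+$. Then the optimal allocation function is \[q^*(\theta)=\begin{cases}q_{\mu^*}(\theta)&\text{for }\theta_L^*\le\theta\le\overline\theta,\\ q^{\mathrm{LF}}(\theta)&\text{for }\underline\theta\le\theta<\theta_L^*.\end{cases}\]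
   Context: Primitives: constants $A>0$, $c>0$, $0<\underline\theta<\overline\theta$; a function $v:[0,A]\to[0,\infty)$, twice continuously differentiable with $v'>0$ and $v''<0$; an absolutely continuous cumulative distribution function $F$ with positive density $f$ on $[\underline\theta,\overline\theta]$; a continuous function $\omega:[\underline\theta,\overline\theta]\to[0,\infty)$ (welfare weights); a constant $\alpha>0$ (welfare weight of profit). "Increasing" is meant strictly. $\mathbf E[\omega]=\int\omega\,dF$ and $(x)_+=\max\{x,0\}$. Laissez-faire: $U^{\mathrm{LF}}(\theta)=\max_{q\in[0,A]}[\theta v(q)-cq]$, and $q^{\mathrm{LF}}(\theta)$ is the unique maximizer. A mechanism is a pair $(q,t)$ with $q:[\underline\theta,\overline\theta]\to[0,A]$ and $t:[\underline\theta,\overline\theta]\to\mathbb R$. It is feasible if it satisfies, for all $\theta$: (IC) $\theta\in\arg\max_{\theta'}[\theta v(q(\theta'))-t(\theta')]$; (IR) $\theta v(q(\theta))-t(\theta)\ge U^{\mathrm{LF}}(\theta)$; (LS) $t(\theta)\ge 0$. The social planner maximizes, over feasible mechanisms, $\int_{\underline\theta}^{\overline\theta}\big[\omega(\theta)[\theta v(q(\theta))-t(\theta)]+\alpha[t(\theta)-cq(\theta)]\big]\,dF(\theta)$. The optimal allocation function is the allocation component $q^*$ of a solution; it is (essentially) unique. Demand: for $x\in\mathbb R$, $D(c,x)$ is the unique maximizer of $q\mapsto x v(q)-cq$ over $[0,A]$; for $x>0$ this equals $(v')^{-1}(c/x)$, where $(v')^{-1}(z)=0$ for $z\ge v'(0)$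 and $(v')^{-1}(z)=A$ for $z\le v'(A)$. Ironing: for a generalized function $h$ on $[\underline\theta,\overline\theta]$, its ironed version is the nondecreasing function $\overline h(\theta)=-\frac{d}{dz}\Big(\mathrm{co}\,\Phi_h\Big)(z)\Big|_{z=F(\theta)}$, where $\Phi_h(z)=\int_{F^{-1}(z)}^{\overline\theta}h(s)\,dF(s)$ for $z\in[0,1]$ and $\mathrm{co}\,\Phi$ is the pointwise smallest concave function that is no smaller than $\Phi$ (one-sided derivatives at endpoints). $\delta_{\underline\theta}$ is the Dirac delta at $\underline\theta$; the term $\frac{\mu\underline\theta\delta_{\underline\theta}}{\alpha f}$ in $h$ contributes to $\Phi_h(z)$ the amount $\mu\underline\theta/\alpha$ at $z=0$ and $0$ for $z>0$. *)

theory Defs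
  imports "HOL-Probability.Probability"
begin

record economy =
  cap :: real                  \<comment> \<open>A\<close>
  cost :: real                 \<comment> \<open>c\<close>
  lo :: real                   \<comment> \<open>lower end of the type interval\<close>
  hi :: real                   \<comment> \<open>upper end of the type interval\<close>
  val :: "real \<Rightarrow> real"        \<comment> \<open>v\<close>
  dens :: "real \<Rightarrow> real"       \<comment> \<open>f\<close>
  weight :: "real \<Rightarrow> real"     \<comment> \<open>omega\<close>
  pweight :: real              \<comment> \<open>alpha, the welfare weight of profit\<close>

definition types :: "economy \<Rightarrow> real set" where
  "types E = {lo E..hi E}"

text \<open>The law of the type, i.e. the measure written dF. It depends on the density only through
  its values on the type interval.\<close>

definition dF :: "economy \<Rightarrow> real measure" where
  "dF E = density lborel (\<lambda>x. ennreal (indicator (types E) x * dens E x))"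

definition F :: "economy \<Rightarrow> real \<Rightarrow> real" where
  "F E = cdf (dF E)"

definition valid_economy :: "economy \<Rightarrow> bool" where
  "valid_economy E \<longleftrightarrow>
     0 < cap E \<and> 0 < cost E \<and> 0 < lo E \<and> lo E < hi E \<and> 0 < pweight E \<and>
     (\<forall>x\<in>{0..cap E}. 0 \<le> val E x) \<and>
     (\<exists>v' v''. continuous_on {0..cap E} v'' \<and>
        (\<forall>x\<in>{0..cap E}. (val E has_real_derivative v' x) (at x within {0..cap E}) \<and>
                         (v' has_real_derivative v'' x) (at x within {0..cap E}) \<and>
                         0 < v' x \<and> v'' x < 0)) \<and>
     set_borel_measurable borel (types E) (dens E) \<and>
     (\<forall>\<theta>\<in>types E. 0 < dens E \<theta>) \<and>
     prob_space (dF E) \<and>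
     continuous_on (types E) (weight E) \<and>
     (\<forall>\<theta>\<in>types E. 0 \<le> weight E \<theta>)"

definition mean_weight :: "economy \<Rightarrow> real" where
  "mean_weight E = (LINT \<theta>:types E|dF E. weight E \<theta>)"

definition demand :: "economy \<Rightarrow> real \<Rightarrow> real \<Rightarrow> real" where
  "demand E k x = arg_max_on (\<lambda>q. x * val E q - k * q) {0..cap E}"

definition U_LF :: "economy \<Rightarrow> real \<Rightarrow> real" where
  "U_LF E \<theta> = (SUP q\<in>{0..cap E}. \<theta> * val E q - cost E * q)"

definition q_LF :: "economy \<Rightarrow> real \<Rightarrow> real" where
  "q_LF E \<theta> = arg_max_on (\<lambda>q. \<theta> * val E q - cost E * q) {0..cap E}"

definition feasible :: "economy \<Rightarrow> (real \<Rightarrow> real) \<Rightarrow> (real \<Rightarrow> real) \<Rightarrow> bool" where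
  "feasible E q t \<longleftrightarrow>
     (\<forall>\<theta>\<in>types E. q \<theta> \<in> {0..cap E}) \<and>
     (\<forall>\<theta>\<in>types E. \<forall>\<theta>'\<in>types E. \<theta> * val E (q \<theta>') - t \<theta>' \<le> \<theta> * val E (q \<theta>) - t \<theta>) \<and>
     (\<forall>\<theta>\<in>types E. U_LF E \<theta> \<le> \<theta> * val E (q \<theta>) - t \<theta>) \<and>
     (\<forall>\<theta>\<in>types E. 0 \<le> t \<theta>)"

definition welfare :: "economy \<Rightarrow> (real \<Rightarrow> real) \<Rightarrow> (real \<Rightarrow> real) \<Rightarrow> real" where
  "welfare E q t =
     (LINT \<theta>:types E|dF E. weight E \<theta> * (\<theta> * val E (q \<theta>) - t \<theta>)
                            + pweight E * (t \<theta> - cost E * q \<theta>))"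

definition optimal :: "economy \<Rightarrow> (real \<Rightarrow> real) \<Rightarrow> (real \<Rightarrow> real) \<Rightarrow> bool" where
  "optimal E q t \<longleftrightarrow>
     feasible E q t \<and> (\<forall>q' t'. feasible E q' t' \<longrightarrow> welfare E q' t' \<le> welfare E q t)"

text \<open>A generalized function on the type interval is encoded as a pair \<open>(h, m)\<close>: an ordinary
  function \<open>h\<close> and the mass \<open>m\<close> that its Dirac term at \<open>lo E\<close> has after integration against dF.
  A term \<open>w(\<theta>) \<delta>(\<theta>) / f(\<theta>)\<close> therefore has mass \<open>w(lo E)\<close>.\<close>

type_synonym gen_fun = "(real \<Rightarrow> real) \<times> real"

definition tail_integral :: "economy \<Rightarrow> gen_fun \<Rightarrow> real \<Rightarrow> real" where
  "tail_integral E h z =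
     (LINT s:{inv_into (types E) (F E) z..hi E}|dF E. fst h s) + (if z = 0 then snd h else 0)"

definition concave_hull :: "(real \<Rightarrow> real) \<Rightarrow> real \<Rightarrow> real" where
  "concave_hull \<Phi> z =
     Inf {g z | g. concave_on {0..1} g \<and> (\<forall>x\<in>{0..1}. \<Phi> x \<le> g x)}"

text \<open>The concave hull may have (countably many) kinks in the interior of \<open>[0,1]\<close>; there the
  right derivative is used. At 1 it is the left derivative.\<close>

definition ironed :: "economy \<Rightarrow> gen_fun \<Rightarrow> real \<Rightarrow> real" where
  "ironed E h \<theta> =
     (let z = F E \<theta> in
      - vector_derivative (concave_hull (tail_integral E h))
          (at z within (if z < 1 then {z..1} else {0..1})))"

definition J :: "economy \<Rightarrow> real \<Rightarrow> gen_fun" where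
  "J E \<mu> =
     (\<lambda>\<theta>. \<theta> - (LINT s:{\<theta>..hi E}|dF E. pweight E - weight E s) / (pweight E * dens E \<theta>),
      \<mu> * lo E / pweight E)"

definition q_mu :: "economy \<Rightarrow> real \<Rightarrow> real \<Rightarrow> real" where
  "q_mu E \<mu> \<theta> = demand E (cost E) (ironed E (J E \<mu>) \<theta>)"

end

(*
  Let G(x) be the integral of alpha - omega over [x, hi]; since omega increases, G is positive
  below theta_L, nonpositive above it, and mu* = - G(theta_L). By the envelope formula and an
  integration by parts, the welfare of an incentive compatible (q, t) with utility U and V = v(q) is

    - int_{[lo, theta_L)} (alpha - omega) U dF + mu* U(theta_L) - alpha int_{[theta_L, hi]} (R - J) V dF
    + alpha int (R V - c q) dF,

  where R(x) = x below theta_L and R is the ironed virtual type above it. Participation bounds U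
  from below where it carries a negative weight, and t(lo) >= 0 bounds U(theta_L) from above when
  mu* > 0, in which case theta_L = lo. The tail integrals of R - J are the gap between the concave
  hull and Phi, hence nonnegative, so the third term is at most - mu* lo V(theta_L) for every
  nondecreasing V. What remains is maximized pointwise by q = D(c, R), uniquely because v is strictly
  concave. All inequalities are equalities there: V moves only where the hull touches Phi.
  R(x) >= x gives participation.
*)
theory Submission
  imports Defs
begin

section \<open>Primitives and monotone integrands\<close>

text \<open>The density is only positive and integrable, neither continuous nor bounded away from
  zero, and v(q), the ironed virtual type and the slope of the hull may jump. Pointwise derivatives
  are therefore avoided: the basic integral identities are obtained by comparing increments over
  short intervals, with errors small relative to the increments of a monotone function. Of the hull
  this uses only that its one-sided derivatives bracket chord slopes and are locally constant off
  the contact set.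

  The delicate point is the left end of the ironed region. The Dirac term makes
  \<open>\<Phi>\<close> jump at quantile 0, but \<open>\<mu>\<close> is positive only if
  \<open>\<theta>L\<close> is the lowest type, so a jump always sits at the contact point
  \<open>F E \<theta>L\<close>, and the slope of the hull has to be understood only from there on.
  At that point the hull retains the Dirac mass while the ordinary tail integral does not, which
  leaves exactly the gap \<open>\<mu> * a / \<alpha>\<close> that offsets the welfare weight of the
  utility at \<open>\<theta>L\<close>.\<close>

lemma increments_negligible_imp_eq:
  fixes P g :: "real \<Rightarrow> real"
  assumes "a \<le> b"
    and small: "\<And>e. 0 < e \<Longrightarrow> \<exists>d>0. \<forall>u w. a \<le> u \<longrightarrow> u \<le> w \<longrightarrow> w \<le> b \<longrightarrow> w - u < d \<longrightarrow>
        \<bar>P w - P u\<bar> \<le> e * (g w - g u)"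
  shows "P b = P a"
proof -
  \<comment> \<open>Over an equipartition with mesh below d the bounds telescope. The function
    \<open>g\<close> absorbs jumps: errors must be small only relative to its increments.\<close>
  have main: "\<bar>P b - P a\<bar> \<le> e * (g b - g a)" if "0 < e" for e
  proof -
    obtain d where "d > 0" and d: "\<And>u w. a \<le> u \<Longrightarrow> u \<le> w \<Longrightarrow> w \<le> b \<Longrightarrow> w - u < d \<Longrightarrow>
        \<bar>P w - P u\<bar> \<le> e * (g w - g u)"
      using small[OF \<open>0 < e\<close>] by blast
    obtain n :: nat where n: "(b - a) / d < real n"
      using reals_Archimedean2 by blast
    have "0 \<le> (b - a) / d" using \<open>a \<le> b\<close> \<open>d > 0\<close> by simp
    with n have n0: "real n > 0" by linarith
    define x where "x i = a + real i * ((b - a) / real n)" for i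
    have step: "x (Suc i) - x i = (b - a) / real n" for i
      by (simp add: x_def distrib_right add_divide_distrib)
    have step_lt: "(b - a) / real n < d"
      using n n0 \<open>d > 0\<close> by (simp add: field_simps)
    have xn: "x n = b" using n0 by (simp add: x_def)
    have "i \<le> n \<Longrightarrow> a \<le> x i \<and> x i \<le> b \<and> \<bar>P (x i) - P a\<bar> \<le> e * (g (x i) - g a)" for i
    proof (induction i)
      case 0
      then show ?case using \<open>a \<le> b\<close> by (simp add: x_def)
    next
      case (Suc i)
      have "0 \<le> (b - a) / real n" using \<open>a \<le> b\<close> by simp
      then have le: "x i \<le> x (Suc i)" using step[of i] by linarith
      have "real (Suc i) * ((b - a) / real n) \<le> real n * ((b - a) / real n)"
        using Suc.prems \<open>0 \<le> (b - a) / real n\<close> by (intro mult_right_mono) auto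
      then have "x (Suc i) \<le> x n" by (simp add: x_def)
      then have le_b: "x (Suc i) \<le> b" using xn by simp
      have IH: "a \<le> x i" "\<bar>P (x i) - P a\<bar> \<le> e * (g (x i) - g a)" using Suc by auto
      have "\<bar>P (x (Suc i)) - P (x i)\<bar> \<le> e * (g (x (Suc i)) - g (x i))"
        using d[OF IH(1) le le_b] step[of i] step_lt by simp
      then show ?case using IH le le_b by (auto simp: algebra_simps abs_le_iff)
    qed
    from this[of n] xn show ?thesis by simp
  qed
  have "\<bar>P b - P a\<bar> \<le> e" if "0 < e" for e
  proof -
    \<comment> \<open>The rescaled e compensates for the total increment of \<open>g\<close>; the
      \<open>+ 1\<close> keeps the divisor positive.\<close>
    have "\<bar>P b - P a\<bar> \<le> e / (\<bar>g b - g a\<bar> + 1) * (g b - g a)"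
      using main[of "e / (\<bar>g b - g a\<bar> + 1)"] that by simp
    also have "\<dots> \<le> e / (\<bar>g b - g a\<bar> + 1) * (\<bar>g b - g a\<bar> + 1)"
      using that by (intro mult_left_mono) auto
    also have "\<dots> = e" by simp
    finally show ?thesis .
  qed
  then have "\<bar>P b - P a\<bar> \<le> 0" by (rule field_le_epsilon) simp
  then show ?thesis by simp
qed

lemma uniform_modulus:
  fixes h :: "real \<Rightarrow> real"
  assumes "continuous_on {a..b} h" "0 < e"
  obtains d where "0 < d"
    "\<And>u w. a \<le> u \<Longrightarrow> u \<le> b \<Longrightarrow> a \<le> w \<Longrightarrow> w \<le> b \<Longrightarrow> \<bar>w - u\<bar> < d \<Longrightarrow> \<bar>h w - h u\<bar> < e"
proof -
  have "uniformly_continuous_on {a..b} h"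
    using assms by (intro compact_uniformly_continuous) auto
  then show ?thesis using assms(2) that
    unfolding uniformly_continuous_on_def dist_real_def by (metis atLeastAtMost_iff)
qed

lemma integral_diff_left:
  fixes n :: "real \<Rightarrow> real"
  assumes "n integrable_on {a..b}" "a \<le> u" "u \<le> w" "w \<le> b"
  shows "integral {a..w} n - integral {a..u} n = integral {u..w} n"
proof -
  have "n integrable_on {a..w}" using assms by (auto intro: integrable_subinterval_real)
  then show ?thesis using Henstock_Kurzweil_Integration.integral_combine[of a u w n] assms by auto
qed

lemma integral_diff_right:
  fixes n :: "real \<Rightarrow> real"
  assumes "n integrable_on {a..b}" "a \<le> u" "u \<le> w" "w \<le> b"
  shows "integral {u..b} n - integral {w..b} n = integral {u..w} n"
proof -
  have "n integrable_on {u..b}" using assms by (auto intro: integrable_subinterval_real)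
  then show ?thesis using Henstock_Kurzweil_Integration.integral_combine[of u w b n] assms by auto
qed

text \<open>The second mean value theorem yields integrability along with its formula, with
  \<open>n\<close> merely gauge integrable and \<open>g\<close> possibly discontinuous.\<close>

lemma integrable_mono_mult:
  fixes g n :: "real \<Rightarrow> real"
  assumes "n integrable_on {a..b}" "mono_on {a..b} g"
  shows "(\<lambda>x. g x * n x) integrable_on {a..b}"
proof (cases "a \<le> b")
  case True
  obtain c where "((\<lambda>x. g x * n x) has_integral
      (g a * integral {a..c} n + g b * integral {c..b} n)) {a..b}"
    using second_mean_value_theorem_full[OF assms(1) True, of g] assms(2)
    by (metis (no_types, lifting) atLeastAtMost_iff mono_onD order_trans)
  then show ?thesis by blast
qed (simp add: integrable_on_empty)

text \<open>\<open>P\<close> and the integral of \<open>g x * n x\<close> obey the same bracketing,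
  so their increments differ by at most \<open>g w - g u\<close> times the integral of
  \<open>n\<close>, which is uniformly small on short intervals. With \<open>n = 1\<close> this
  yields the envelope formula, with \<open>n = f\<close> the integral of the ironed virtual
  type.\<close>

lemma mono_mult_has_integral:
  fixes g n P :: "real \<Rightarrow> real"
  assumes "a \<le> b" and n: "n integrable_on {a..b}" and n0: "\<And>x. x \<in> {a..b} \<Longrightarrow> 0 \<le> n x"
    and g: "mono_on {a..b} g"
    and P: "\<And>u w. a \<le> u \<Longrightarrow> u < w \<Longrightarrow> w \<le> b \<Longrightarrow>
        g u * integral {u..w} n \<le> P w - P u \<and> P w - P u \<le> g w * integral {u..w} n"
  shows "((\<lambda>x. g x * n x) has_integral (P b - P a)) {a..b}"
proof -
  have gn: "(\<lambda>x. g x * n x) integrable_on {a..b}"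
    by (rule integrable_mono_mult[OF n g])
  define Q where "Q x = integral {a..x} (\<lambda>x. g x * n x) - P x" for x
  have "Q b = Q a"
  proof (rule increments_negligible_imp_eq[OF \<open>a \<le> b\<close>, of Q g])
    fix e :: real assume "0 < e"
    have "continuous_on {a..b} (\<lambda>x. integral {a..x} n)"
      using n by (rule indefinite_integral_continuous_1)
    then obtain d where d: "0 < d" "\<And>u w. a \<le> u \<Longrightarrow> u \<le> b \<Longrightarrow> a \<le> w \<Longrightarrow> w \<le> b \<Longrightarrow> \<bar>w - u\<bar> < d \<Longrightarrow>
        \<bar>integral {a..w} n - integral {a..u} n\<bar> < e"
      using uniform_modulus \<open>0 < e\<close> by metis
    have "\<bar>Q w - Q u\<bar> \<le> e * (g w - g u)" if uw: "a \<le> u" "u \<le> w" "w \<le> b" "w - u < d" for u w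
    proof (cases "u = w")
      case False
      have nuw: "n integrable_on {u..w}" "(\<lambda>x. g x * n x) integrable_on {u..w}"
        using uw n gn by (auto intro: integrable_subinterval_real)
      have N: "integral {u..w} n < e"
        using d(2)[of u w] uw integral_diff_left[OF n, of u w] by auto
      have gle: "g u \<le> g w" using g uw by (auto simp: mono_on_def)
      have "g u * integral {u..w} n \<le> integral {u..w} (\<lambda>x. g x * n x)"
      proof -
        have "integral {u..w} (\<lambda>x. g u * n x) \<le> integral {u..w} (\<lambda>x. g x * n x)"
          using uw n0 g nuw by (intro integral_le integrable_on_mult_right mult_right_mono) (auto simp: mono_on_def)
        then show ?thesis by simp
      qed
      moreover have "integral {u..w} (\<lambda>x. g x * n x) \<le> g w * integral {u..w} n"
      proof -
        have "integral {u..w} (\<lambda>x. g x * n x) \<le> integral {u..w} (\<lambda>x. g w * n x)"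
          using uw n0 g nuw by (intro integral_le integrable_on_mult_right mult_right_mono) (auto simp: mono_on_def)
        then show ?thesis by simp
      qed
      moreover have "Q w - Q u = integral {u..w} (\<lambda>x. g x * n x) - (P w - P u)"
        using integral_diff_left[OF gn uw(1-3)] by (simp add: Q_def)
      moreover have "g u * integral {u..w} n \<le> P w - P u \<and> P w - P u \<le> g w * integral {u..w} n"
        using P uw False by auto
      ultimately have "\<bar>Q w - Q u\<bar> \<le> (g w - g u) * integral {u..w} n"
        by (auto simp: algebra_simps abs_le_iff)
      also have "\<dots> \<le> (g w - g u) * e" using gle N by (intro mult_left_mono) auto
      finally show ?thesis by (simp add: mult.commute)
    qed simp
    with d(1) show "\<exists>d>0. \<forall>u w. a \<le> u \<longrightarrow> u \<le> w \<longrightarrow> w \<le> b \<longrightarrow> w - u < d \<longrightarrow>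
        \<bar>Q w - Q u\<bar> \<le> e * (g w - g u)" by blast
  qed
  then have "integral {a..b} (\<lambda>x. g x * n x) = P b - P a" by (simp add: Q_def)
  with gn show ?thesis by (simp add: has_integral_iff)
qed

lemma absolutely_integrable_continuous_mult:
  fixes h n :: "real \<Rightarrow> real"
  assumes "continuous_on {a..b} h" "n absolutely_integrable_on {a..b}"
  shows "(\<lambda>x. h x * n x) absolutely_integrable_on {a..b}"
  using assms
  by (intro absolutely_integrable_bounded_measurable_product_real)
     (auto intro: continuous_imp_measurable_on_sets_lebesgue compact_imp_bounded
        compact_continuous_image)

text \<open>The primitives are only absolutely continuous. On a short interval they are nearly
  constant, and the error is at most e times the integral of
  \<open>\<bar>p x\<bar> + \<bar>q x\<bar>\<close>.\<close>

lemma integration_by_parts_primitives: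
  fixes p q :: "real \<Rightarrow> real"
  assumes "a \<le> b" and p: "p absolutely_integrable_on {a..b}" and q: "q absolutely_integrable_on {a..b}"
    and P: "\<And>u w. a \<le> u \<Longrightarrow> u \<le> w \<Longrightarrow> w \<le> b \<Longrightarrow> P w - P u = integral {u..w} p"
    and Q: "\<And>u w. a \<le> u \<Longrightarrow> u \<le> w \<Longrightarrow> w \<le> b \<Longrightarrow> Q w - Q u = integral {u..w} q"
  shows "integral {a..b} (\<lambda>x. Q x * p x) = P b * Q b - P a * Q a - integral {a..b} (\<lambda>x. P x * q x)"
proof -
  have pi: "p integrable_on {a..b}" and qi: "q integrable_on {a..b}"
    using p q set_lebesgue_integral_eq_integral(1) by blast+
  have "continuous_on {a..b} (\<lambda>x. P a + integral {a..x} p)"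
    using pi by (intro continuous_intros indefinite_integral_continuous_1)
  moreover have "P a + integral {a..x} p = P x" if "x \<in> {a..b}" for x
    using P[of a x] that by auto
  ultimately have cP: "continuous_on {a..b} P"
    by (rule continuous_on_eq)
  have "continuous_on {a..b} (\<lambda>x. Q a + integral {a..x} q)"
    using qi by (intro continuous_intros indefinite_integral_continuous_1)
  moreover have "Q a + integral {a..x} q = Q x" if "x \<in> {a..b}" for x
    using Q[of a x] that by auto
  ultimately have cQ: "continuous_on {a..b} Q"
    by (rule continuous_on_eq)
  have Qp: "(\<lambda>x. Q x * p x) integrable_on {a..b}"
    using absolutely_integrable_continuous_mult[OF cQ p] set_lebesgue_integral_eq_integral(1) by blast
  have Pq: "(\<lambda>x. P x * q x) integrable_on {a..b}"
    using absolutely_integrable_continuous_mult[OF cP q] set_lebesgue_integral_eq_integral(1) by blast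
  have api: "(\<lambda>x. \<bar>p x\<bar> + \<bar>q x\<bar>) integrable_on {a..b}"
    using p q by (auto simp: absolutely_integrable_on_def intro!: integrable_add)
  define R where "R x = integral {a..x} (\<lambda>x. Q x * p x) + integral {a..x} (\<lambda>x. P x * q x) - P x * Q x" for x
  have "R b = R a"
  proof (rule increments_negligible_imp_eq[OF \<open>a \<le> b\<close>,
        of R "\<lambda>x. integral {a..x} (\<lambda>x. \<bar>p x\<bar> + \<bar>q x\<bar>)"])
    fix e :: real assume e: "0 < e"
    obtain d1 where d1: "0 < d1" "\<And>u w. a \<le> u \<Longrightarrow> u \<le> b \<Longrightarrow> a \<le> w \<Longrightarrow> w \<le> b \<Longrightarrow> \<bar>w - u\<bar> < d1 \<Longrightarrow>
        \<bar>P w - P u\<bar> < e" using uniform_modulus[OF cP e] by metis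
    obtain d2 where d2: "0 < d2" "\<And>u w. a \<le> u \<Longrightarrow> u \<le> b \<Longrightarrow> a \<le> w \<Longrightarrow> w \<le> b \<Longrightarrow> \<bar>w - u\<bar> < d2 \<Longrightarrow>
        \<bar>Q w - Q u\<bar> < e" using uniform_modulus[OF cQ e] by metis
    have "\<bar>R w - R u\<bar> \<le> e * (integral {a..w} (\<lambda>x. \<bar>p x\<bar> + \<bar>q x\<bar>) - integral {a..u} (\<lambda>x. \<bar>p x\<bar> + \<bar>q x\<bar>))"
      if uw: "a \<le> u" "u \<le> w" "w \<le> b" "w - u < min d1 d2" for u w
    proof -
      have i: "p integrable_on {u..w}" "q integrable_on {u..w}" "(\<lambda>x. Q x * p x) integrable_on {u..w}"
        "(\<lambda>x. P x * q x) integrable_on {u..w}" "(\<lambda>x. \<bar>p x\<bar> + \<bar>q x\<bar>) integrable_on {u..w}"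
        using uw pi qi Qp Pq api by (auto intro: integrable_subinterval_real)
      have "R w - R u = integral {u..w} (\<lambda>x. Q x * p x) + integral {u..w} (\<lambda>x. P x * q x) - (P w * Q w - P u * Q u)"
        using integral_diff_left[OF Qp uw(1-3)] integral_diff_left[OF Pq uw(1-3)] by (simp add: R_def)
      \<comment> \<open>Freezing \<open>Q\<close> at the right end and \<open>P\<close> at the left
        splits the increment of the product exactly, without a cross term.\<close>
      also have "\<dots> = integral {u..w} (\<lambda>x. Q x * p x) + integral {u..w} (\<lambda>x. P x * q x)
          - (Q w * integral {u..w} p + P u * integral {u..w} q)"
        using P[OF uw(1-3)] Q[OF uw(1-3)] by (simp add: algebra_simps flip: P Q)
      also have "\<dots> = integral {u..w} (\<lambda>x. (Q x - Q w) * p x + (P x - P u) * q x)"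
        using i by (simp add: algebra_simps integral_add integral_diff integrable_add integrable_diff
            integrable_on_mult_right integrable_on_mult_left)
      also have "norm \<dots> \<le> integral {u..w} (\<lambda>x. e * (\<bar>p x\<bar> + \<bar>q x\<bar>))"
      proof (rule integral_norm_bound_integral)
        have "(\<lambda>x. (Q x * p x - Q w * p x) + (P x * q x - P u * q x)) integrable_on {u..w}"
          using i by (intro integrable_add integrable_diff integrable_on_mult_right)
        then show "(\<lambda>x. (Q x - Q w) * p x + (P x - P u) * q x) integrable_on {u..w}"
          by (simp add: algebra_simps)
        show "(\<lambda>x. e * (\<bar>p x\<bar> + \<bar>q x\<bar>)) integrable_on {u..w}"
          using i by (intro integrable_on_mult_right)
        fix x assume x: "x \<in> {u..w}"
        have "\<bar>Q x - Q w\<bar> \<le> e" "\<bar>P x - P u\<bar> \<le> e"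
          using d2(2)[of w x] d1(2)[of u x] uw x by auto
        then have "\<bar>(Q x - Q w) * p x\<bar> \<le> e * \<bar>p x\<bar>" "\<bar>(P x - P u) * q x\<bar> \<le> e * \<bar>q x\<bar>"
          by (auto simp: abs_mult intro: mult_right_mono)
        then show "norm ((Q x - Q w) * p x + (P x - P u) * q x) \<le> e * (\<bar>p x\<bar> + \<bar>q x\<bar>)"
          by (simp add: algebra_simps)
      qed
      also have "\<dots> = e * (integral {a..w} (\<lambda>x. \<bar>p x\<bar> + \<bar>q x\<bar>) - integral {a..u} (\<lambda>x. \<bar>p x\<bar> + \<bar>q x\<bar>))"
        using integral_diff_left[OF api uw(1-3)] by simp
      finally show ?thesis by simp
    qed
    then show "\<exists>d>0. \<forall>u w. a \<le> u \<longrightarrow> u \<le> w \<longrightarrow> w \<le> b \<longrightarrow> w - u < d \<longrightarrow> \<bar>R w - R u\<bar> \<le>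
        e * (integral {a..w} (\<lambda>x. \<bar>p x\<bar> + \<bar>q x\<bar>) - integral {a..u} (\<lambda>x. \<bar>p x\<bar> + \<bar>q x\<bar>))"
      using d1(1) d2(1) by (intro exI[of _ "min d1 d2"]) auto
  qed
  then show ?thesis by (simp add: R_def)
qed

section \<open>Integrals of a monotone function against a signed kernel\<close>

lemma integral_mono_mult_ge:
  fixes V K :: "real \<Rightarrow> real"
  assumes "a \<le> b" and K: "K integrable_on {a..b}" and V: "mono_on {a..b} V"
    and tail: "\<And>x. x \<in> {a..b} \<Longrightarrow> 0 \<le> integral {x..b} K"
  shows "V a * integral {a..b} K \<le> integral {a..b} (\<lambda>x. V x * K x)"
proof -
  \<comment> \<open>The second mean value theorem concentrates the variation of \<open>V\<close> at
    a single point c, so only the sign of the tail integral at c matters.\<close>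
  obtain c where c: "c \<in> {a..b}"
    and eq: "integral {a..b} (\<lambda>x. V x * K x) = V a * integral {a..c} K + V b * integral {c..b} K"
  proof (rule second_mean_value_theorem[OF K \<open>a \<le> b\<close>, of V])
    show "V x \<le> V y" if "a \<le> x" "x \<le> y" "y \<le> b" for x y
      using V that by (auto simp: mono_on_def)
  qed
  have eq2: "integral {a..c} K = integral {a..b} K - integral {c..b} K"
    using integral_diff_right[OF K, of a c] c by auto
  then have "integral {a..b} (\<lambda>x. V x * K x) = V a * integral {a..b} K + (V b - V a) * integral {c..b} K"
    unfolding eq eq2 by (simp add: algebra_simps)
  moreover have "0 \<le> (V b - V a) * integral {c..b} K"
    using tail[OF c] V \<open>a \<le> b\<close> by (auto simp: mono_on_def)
  ultimately show ?thesis by linarith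
qed

text \<open>Complementary slackness: \<open>V\<close> moves only where the tail integral of \<open>K\<close> vanishes.\<close>

lemma integral_mono_mult_eq:
  fixes V K :: "real \<Rightarrow> real"
  assumes "a \<le> b" and K: "K integrable_on {a..b}" and V: "mono_on {a..b} V"
    and zero: "\<And>u w. a \<le> u \<Longrightarrow> u \<le> w \<Longrightarrow> w \<le> b \<Longrightarrow> V u < V w \<Longrightarrow> \<exists>x\<in>{u..w}. integral {x..b} K = 0"
  shows "integral {a..b} (\<lambda>x. V x * K x) = V a * integral {a..b} K"
proof -
  define T where "T x = integral {x..b} K" for x
  have VK: "(\<lambda>x. V x * K x) integrable_on {a..b}"
    by (rule integrable_mono_mult[OF K V])
  have "continuous_on {a..b} (\<lambda>x. integral {x..b} K)"
    using K by (rule indefinite_integral_continuous_1')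
  then have cT: "continuous_on {a..b} T" by (simp add: T_def[abs_def])
  \<comment> \<open>As \<open>T b = 0\<close>, \<open>P\<close> is the integral in question at b and
    \<open>V a * T a\<close> at a, so increments negligible against those of \<open>V\<close>
    suffice.\<close>
  define P where "P x = integral {a..x} (\<lambda>x. V x * K x) + V x * T x" for x
  have "P b = P a"
  proof (rule increments_negligible_imp_eq[OF \<open>a \<le> b\<close>, of P V])
    fix e :: real assume e: "0 < e"
    obtain d where d: "0 < d" "\<And>u w. a \<le> u \<Longrightarrow> u \<le> b \<Longrightarrow> a \<le> w \<Longrightarrow> w \<le> b \<Longrightarrow> \<bar>w - u\<bar> < d \<Longrightarrow>
        \<bar>T w - T u\<bar> < e" using uniform_modulus[OF cT e] by metis
    have "\<bar>P w - P u\<bar> \<le> e * (V w - V u)" if uw: "a \<le> u" "u \<le> w" "w \<le> b" "w - u < d" for u w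
    proof -
      have Kuw: "K integrable_on {u..w}" using uw K by (auto intro: integrable_subinterval_real)
      have V': "V x \<le> V y" if "u \<le> x" "x \<le> y" "y \<le> w" for x y
        using that uw V by (auto simp: mono_on_def)
      obtain c where c: "c \<in> {u..w}"
        and eq: "integral {u..w} (\<lambda>x. V x * K x) = V u * integral {u..c} K + V w * integral {c..w} K"
        using second_mean_value_theorem[OF Kuw uw(2), where g=V] V' by blast
      have i1: "integral {u..c} K = T u - T c" "integral {c..w} K = T c - T w"
        using integral_diff_right[OF K, of u c] integral_diff_right[OF K, of c w] uw c
        by (auto simp: T_def)
      have pp: "P w - P u = integral {u..w} (\<lambda>x. V x * K x) + V w * T w - V u * T u"
        using integral_diff_left[OF VK uw(1-3)] by (simp add: P_def)
      \<comment> \<open>When \<open>V\<close> moves between u and w, \<open>T c\<close> is close to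
        a zero of \<open>T\<close>.\<close>
      have PP: "P w - P u = (V w - V u) * T c" unfolding pp eq i1 by (simp add: algebra_simps)
      show ?thesis
      proof (cases "V u < V w")
        case True
        then obtain x where x: "x \<in> {u..w}" "T x = 0"
          using zero[OF uw(1-3) True] unfolding T_def by blast
        then have "\<bar>T c\<bar> < e" using d(2)[of x c] uw c by auto
        then have "(V w - V u) * \<bar>T c\<bar> \<le> (V w - V u) * e" using True by (intro mult_left_mono) auto
        then show ?thesis using PP True by (simp add: abs_mult mult.commute)
      next
        case False
        then have "V w = V u" using V'[of u w] uw by auto
        then show ?thesis using PP by simp
      qed
    qed
    with d(1) show "\<exists>d>0. \<forall>u w. a \<le> u \<longrightarrow> u \<le> w \<longrightarrow> w \<le> b \<longrightarrow> w - u < d \<longrightarrow>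
        \<bar>P w - P u\<bar> \<le> e * (V w - V u)" by blast
  qed
  then show ?thesis by (simp add: P_def T_def)
qed

text \<open>The comparison may fail at \<open>w\<close>. It is used up to a type where the ironed
  virtual type may jump, and up to \<open>\<theta>L\<close>, where \<open>\<omega>_below\<close>
  says nothing.\<close>

lemma integral_le_off_right:
  fixes p q :: "real \<Rightarrow> real"
  assumes p: "p integrable_on {u..w}" and q: "q integrable_on {u..w}"
    and le: "\<And>s. u \<le> s \<Longrightarrow> s < w \<Longrightarrow> p s \<le> q s"
  shows "integral {u..w} p \<le> integral {u..w} q"
proof -
  have "integral {u..w} p \<le> integral {u..w} (\<lambda>s. if s = w then p s else q s)"
  proof (rule integral_le[OF p])
    show "(\<lambda>s. if s = w then p s else q s) integrable_on {u..w}"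
      by (rule integrable_spike[OF q, of "{w}"]) auto
  qed (use le in auto)
  also have "\<dots> = integral {u..w} q"
    by (rule integral_spike[of "{w}"]) auto
  finally show ?thesis .
qed

section \<open>Mean values, strict concavity and measurability\<close>

lemma mvt_within:
  fixes h h' :: "real \<Rightarrow> real"
  assumes der: "\<And>z. z \<in> {l..r} \<Longrightarrow> (h has_real_derivative h' z) (at z within {l..r})"
    and xy: "l \<le> x" "x < y" "y \<le> r"
  shows "\<exists>z\<in>{x<..<y}. h y - h x = h' z * (y - x)"
proof -
  have "(h has_derivative (*) (h' z)) (at z within {x..y})" if "x \<le> z" "z \<le> y" for z
    by (rule has_derivative_subset[OF der[unfolded has_field_derivative_def]]) (use that xy in auto)
  then show ?thesis using mvt_simple[OF xy(2), of h "\<lambda>z. (*) (h' z)"] by blast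
qed

text \<open>The two half chords have slopes \<open>v' y\<close> and \<open>v' z\<close> with y < z,
  which the mean value theorem for \<open>v'\<close> orders. The midpoint alone suffices for
  uniqueness of demand.\<close>

lemma strictly_concave_midpoint:
  fixes v v' v'' :: "real \<Rightarrow> real"
  assumes der: "\<And>x. x \<in> {0..A} \<Longrightarrow> (v has_real_derivative v' x) (at x within {0..A})"
    "\<And>x. x \<in> {0..A} \<Longrightarrow> (v' has_real_derivative v'' x) (at x within {0..A})"
    and neg: "\<And>x. x \<in> {0..A} \<Longrightarrow> v'' x < 0"
    and qr: "0 \<le> q" "q < r" "r \<le> A"
  shows "v q + v r < 2 * v ((q + r) / 2)"
proof -
  let ?m = "(q + r) / 2"
  obtain y where y: "y \<in> {q<..<?m}" "v ?m - v q = v' y * (?m - q)"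
    using mvt_within[OF der(1), of q ?m] qr by auto
  obtain z where z: "z \<in> {?m<..<r}" "v r - v ?m = v' z * (r - ?m)"
    using mvt_within[OF der(1), of ?m r] qr by auto
  obtain w where w: "w \<in> {y<..<z}" "v' z - v' y = v'' w * (z - y)"
    using mvt_within[OF der(2), of y z] y(1) z(1) qr by auto
  have "v'' w * (z - y) < 0" using neg[of w] w y(1) z(1) qr by (intro mult_neg_pos) auto
  then have "v' z < v' y" using w by simp
  then have "v' z * ((r - q) / 2) < v' y * ((r - q) / 2)" using qr by (intro mult_strict_right_mono) auto
  moreover have halves: "?m - q = (r - q) / 2" "r - ?m = (r - q) / 2" by (auto simp: field_simps)
  ultimately have "v r - v ?m < v ?m - v q" unfolding y(2) z(2) halves by simp
  then show ?thesis by simp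
qed

lemma integral_zero_nonneg_AE:
  fixes p :: "real \<Rightarrow> real"
  assumes p: "p absolutely_integrable_on S" and nn: "\<And>x. x \<in> S \<Longrightarrow> 0 \<le> p x" and "integral S p = 0"
  shows "AE x in lborel. x \<in> S \<longrightarrow> p x = 0"
proof -
  have "(LINT x:S|lebesgue. p x) = 0"
    using assms by (simp add: set_lebesgue_integral_eq_integral(2))
  then have "AE x in lebesgue. indicator S x *\<^sub>R p x = 0"
    using p nn unfolding set_lebesgue_integral_def set_integrable_def
    by (subst (asm) integral_nonneg_eq_0_iff_AE) (auto simp: indicator_def)
  then have "AE x in lborel. indicator S x *\<^sub>R p x = 0" by (simp add: AE_completion_iff)
  then show ?thesis by eventually_elim auto
qed

lemma set_borel_measurable_mono_on:
  fixes h :: "real \<Rightarrow> real"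
  assumes "mono_on S h" "S \<in> sets borel"
  shows "set_borel_measurable borel S h"
  using borel_measurable_mono_on_fnc[OF assms(1)] assms(2)
  unfolding set_borel_measurable_def by (subst (asm) borel_measurable_restrict_space_iff) auto

lemma absolutely_integrable_mult_bounded:
  fixes h n :: "real \<Rightarrow> real"
  assumes h: "set_borel_measurable borel {u..w} h" and "bounded (h ` {u..w})"
    and n: "n absolutely_integrable_on {u..w}"
  shows "(\<lambda>x. h x * n x) absolutely_integrable_on {u..w}"
proof (rule absolutely_integrable_bounded_measurable_product_real)
  have "(\<lambda>x. indicator {u..w} x *\<^sub>R h x) \<in> borel_measurable lebesgue"
    using h unfolding set_borel_measurable_def by (intro measurable_completion) simp
  then show "h \<in> borel_measurable (lebesgue_on {u..w})"
    by (subst borel_measurable_restrict_space_iff) auto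
qed (use assms in auto)

section \<open>Concave hulls\<close>

lemma concave_on_affine: "convex S \<Longrightarrow> concave_on S (\<lambda>x::real. m + s * (x - p))"
proof -
  have "m + s * (u * x + v * y - p) = u * (m + s * (x - p)) + v * (m + s * (y - p))"
    if "u + v = 1" for u v x y :: real
  proof -
    from that have "v = 1 - u" by simp
    show ?thesis unfolding \<open>v = 1 - u\<close> by (simp add: algebra_simps)
  qed
  then show "convex S \<Longrightarrow> ?thesis" by (simp add: concave_on_iff)
qed

lemma concave_on_Icc_const: "concave_on {a..b::real} (\<lambda>_. K)"
  using concave_on_affine[of "{a..b}" K 0 0] by simp

text \<open>The bound \<open>K\<close> provides a concave majorant; without one the infimum in
  \<open>concave_hull\<close> would range over the empty set.\<close>

lemma concave_hull_upper:
  assumes "\<And>x. x \<in> {0..1} \<Longrightarrow> \<Phi> x \<le> K" "z \<in> {0..1}"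
  shows "\<Phi> z \<le> concave_hull \<Phi> z"
  unfolding concave_hull_def
proof (rule cInf_greatest)
  have "concave_on {0..1} (\<lambda>_::real. K)" by (rule concave_on_Icc_const)
  then show "{g z |g. concave_on {0..1} g \<and> (\<forall>x\<in>{0..1}. \<Phi> x \<le> g x)} \<noteq> {}"
    using assms(1) by blast
qed (use assms in auto)

lemma concave_hull_least:
  assumes "concave_on {0..1} g" "\<And>x. x \<in> {0..1} \<Longrightarrow> \<Phi> x \<le> g x" "z \<in> {0..1}"
  shows "concave_hull \<Phi> z \<le> g z"
  unfolding concave_hull_def
proof (rule cInf_lower)
  show "bdd_below {g z |g. concave_on {0..1} g \<and> (\<forall>x\<in>{0..1}. \<Phi> x \<le> g x)}"
    using assms(3) by (intro bdd_belowI[of _ "\<Phi> z"]) auto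
qed (use assms in auto)

lemma concave_hull_le_line:
  assumes "\<And>x. x \<in> {0..1} \<Longrightarrow> \<Phi> x \<le> m + s * (x - p)" "z \<in> {0..1}"
  shows "concave_hull \<Phi> z \<le> m + s * (z - p)"
  using concave_hull_least[of "\<lambda>x. m + s * (x - p)" \<Phi> z] assms by (simp add: concave_on_affine)

lemma concave_on_concave_hull:
  assumes "\<And>x. x \<in> {0..1} \<Longrightarrow> \<Phi> x \<le> K"
  shows "concave_on {0..1} (concave_hull \<Phi>)"
  unfolding concave_on_iff
proof (intro conjI ballI allI impI)
  fix x y u v :: real
  assume xy: "x \<in> {0..1}" "y \<in> {0..1}" "0 \<le> u" "0 \<le> v" "u + v = 1"
  have "concave_on {0..1} (\<lambda>_::real. K)" by (rule concave_on_Icc_const)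
  then have ne: "{g (u *\<^sub>R x + v *\<^sub>R y) |g. concave_on {0..1} g \<and> (\<forall>x\<in>{0..1}. \<Phi> x \<le> g x)} \<noteq> {}"
    using assms by blast
  have "u * concave_hull \<Phi> x + v * concave_hull \<Phi> y \<le> g (u *\<^sub>R x + v *\<^sub>R y)"
    if g: "concave_on {0..1} g" "\<forall>x\<in>{0..1}. \<Phi> x \<le> g x" for g
  proof -
    have "u * concave_hull \<Phi> x + v * concave_hull \<Phi> y \<le> u * g x + v * g y"
      using xy g by (intro add_mono mult_left_mono concave_hull_least) auto
    also have "\<dots> \<le> g (u *\<^sub>R x + v *\<^sub>R y)"
      using g(1) xy by (simp add: concave_on_iff)
    finally show ?thesis .
  qed
  with ne show "concave_hull \<Phi> (u *\<^sub>R x + v *\<^sub>R y) \<ge> u * concave_hull \<Phi> x + v * concave_hull \<Phi> y"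
    unfolding concave_hull_def[of \<Phi> "u *\<^sub>R x + v *\<^sub>R y"] by (intro cInf_greatest) auto
qed simp

text \<open>The chord inequality with denominators cleared rearranges into every comparison of
  slopes needed below.\<close>

lemma concave_three_points:
  fixes g :: "real \<Rightarrow> real"
  assumes "concave_on {a..b} g" "a \<le> x" "x \<le> y" "y \<le> z" "z \<le> b"
  shows "(z - y) * g x + (y - x) * g z \<le> (z - x) * g y"
proof (cases "x < z")
  case True
  let ?u = "(z - y) / (z - x)" and ?v = "(y - x) / (z - x)"
  have uv: "0 \<le> ?u" "0 \<le> ?v" "?u + ?v = 1"
    using assms True by (auto simp: divide_simps)
  have "?u * g x + ?v * g z \<le> g (?u *\<^sub>R x + ?v *\<^sub>R z)"
    using assms uv unfolding concave_on_iff by (metis atLeastAtMost_iff order_trans)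
  moreover have "?u *\<^sub>R x + ?v *\<^sub>R z = y"
    using True by (simp add: divide_simps) (simp add: algebra_simps)
  ultimately have "?u * g x + ?v * g z \<le> g y" by simp
  then have "((z - y) * g x + (y - x) * g z) / (z - x) \<le> g y"
    by (simp add: add_divide_distrib)
  then show ?thesis using True by (simp add: divide_le_eq mult.commute)
next
  case False
  then have "x = y" "y = z" using assms by auto
  then show ?thesis by simp
qed

section \<open>One-sided derivatives of concave functions\<close>

definition one_sided_deriv :: "(real \<Rightarrow> real) \<Rightarrow> real \<Rightarrow> real" where
  "one_sided_deriv g z = vector_derivative g (at z within (if z < 1 then {z..1} else {0..1}))"

text \<open>Chord slopes from z decrease as w moves away, so their limit at z is their supremum.
  \<open>B\<close> keeps it finite: at 0 a concave function may jump or be infinitely steep.\<close>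

lemma one_sided_deriv_right:
  assumes conc: "concave_on {0..1} g" and z: "0 \<le> z" "z < 1"
    and B: "\<And>w. z < w \<Longrightarrow> w \<le> 1 \<Longrightarrow> g w - g z \<le> B * (w - z)"
  shows "one_sided_deriv g z = (SUP w\<in>{z<..1}. (g w - g z) / (w - z))" (is "_ = ?S")
    and "bdd_above ((\<lambda>w. (g w - g z) / (w - z)) ` {z<..1})"
proof -
  let ?s = "\<lambda>w. (g w - g z) / (w - z)"
  show bdd: "bdd_above (?s ` {z<..1})"
    using B by (intro bdd_aboveI2[of _ _ B]) (auto simp: divide_le_eq)
  have anti: "?s w' \<le> ?s w" if "z < w" "w \<le> w'" "w' \<le> 1" for w w'
    using concave_three_points[OF conc, of z w w'] that z
    by (simp add: divide_simps) (simp add: algebra_simps)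
  have "(?s \<longlongrightarrow> ?S) (at z within {z..1})"
  proof (rule tendstoI)
    fix e :: real assume "0 < e"
    then have "?S - e < ?S" by simp
    then obtain w0 where w0: "w0 \<in> {z<..1}" "?S - e < ?s w0"
      using z by (subst (asm) less_cSUP_iff[OF _ bdd]) auto
    have "dist (?s w) ?S < e" if "w \<in> {z..1}" "w \<noteq> z" "dist w z < w0 - z" for w
    proof -
      have w: "z < w" "w \<le> w0" "w \<le> 1" using that by (auto simp: dist_real_def)
      then have "?s w0 \<le> ?s w" using anti w0 by auto
      moreover have "?s w \<le> ?S" using w by (intro cSUP_upper[OF _ bdd]) auto
      ultimately show ?thesis using w0(2) by (simp add: dist_real_def)
    qed
    then show "\<forall>\<^sub>F w in at z within {z..1}. dist (?s w) ?S < e"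
      using w0(1) by (auto simp: eventually_at intro!: exI[of _ "w0 - z"])
  qed
  then have "(g has_field_derivative ?S) (at z within {z..1})"
    by (simp add: has_field_derivative_iff)
  then have "(g has_vector_derivative ?S) (at z within {z..1})"
    by (simp add: has_real_derivative_iff_has_vector_derivative)
  then show "one_sided_deriv g z = ?S"
    using z by (simp add: one_sided_deriv_def vector_derivative_within_closed_interval)
qed

text \<open>Mirror image at the right end, where the limit of the chord slopes is their infimum;
  \<open>B\<close> excludes a drop or an infinite slope at 1.\<close>

lemma one_sided_deriv_1:
  assumes conc: "concave_on {0..1} g"
    and B: "\<And>w. 0 \<le> w \<Longrightarrow> w < 1 \<Longrightarrow> g w \<le> g 1 + B * (1 - w)"
  shows "one_sided_deriv g 1 = (INF w\<in>{0..<1}. (g 1 - g w) / (1 - w))" (is "_ = ?S")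
    and "bdd_below ((\<lambda>w. (g 1 - g w) / (1 - w)) ` {0..<1})"
proof -
  let ?s = "\<lambda>w. (g 1 - g w) / (1 - w)"
  have "- B \<le> ?s w" if "w \<in> {0..<1}" for w
    using B[of w] that by (auto simp: le_divide_eq algebra_simps)
  then show bdd: "bdd_below (?s ` {0..<1})"
    by (intro bdd_belowI2[of _ "- B"])
  have anti: "?s w' \<le> ?s w" if "0 \<le> w" "w \<le> w'" "w' < 1" for w w'
    using concave_three_points[OF conc, of w w' 1] that
    by (simp add: divide_simps) (simp add: algebra_simps)
  have "(?s \<longlongrightarrow> ?S) (at 1 within {0..1})"
  proof (rule tendstoI)
    fix e :: real assume "0 < e"
    then have "?S < ?S + e" by simp
    then obtain w0 where w0: "w0 \<in> {0..<1}" "?s w0 < ?S + e"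
      by (subst (asm) cINF_less_iff[OF _ bdd]) auto
    have "dist (?s w) ?S < e" if "w \<in> {0..1}" "w \<noteq> 1" "dist w 1 < 1 - w0" for w
    proof -
      have w: "w < 1" "w0 \<le> w" "0 \<le> w" using that by (auto simp: dist_real_def)
      then have "?s w \<le> ?s w0" using anti w0 by auto
      moreover have "?S \<le> ?s w" using w by (intro cINF_lower[OF bdd]) auto
      ultimately show ?thesis using w0(2) by (simp add: dist_real_def)
    qed
    then show "\<forall>\<^sub>F w in at 1 within {0..1}. dist (?s w) ?S < e"
      using w0(1) by (auto simp: eventually_at intro!: exI[of _ "1 - w0"])
  qed
  moreover have "?s = (\<lambda>w. (g w - g 1) / (w - 1))"
    by (intro ext) (metis minus_diff_eq minus_divide_divide)
  ultimately have "(g has_field_derivative ?S) (at 1 within {0..1})"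
    by (simp add: has_field_derivative_iff)
  then have "(g has_vector_derivative ?S) (at 1 within {0..1})"
    by (simp add: has_real_derivative_iff_has_vector_derivative)
  then show "one_sided_deriv g 1 = ?S"
    by (simp add: one_sided_deriv_def vector_derivative_within_closed_interval)
qed

text \<open>\<open>\<Phi>\<close> stands for the tail integral over quantiles,
  \<open>\<Phi>\<^sub>0\<close> for its version without the jump that may occur at p. The two lines
  touch \<open>\<Phi>\<close> at p and at 1, where they pin the hull and keep its slopes finite. To
  the left of p nothing beyond these lines is known about \<open>\<Phi>\<close>.\<close>

locale pinned_hull =
  fixes \<Phi> \<Phi>\<^sub>0 :: "real \<Rightarrow> real" and p s C :: real
  assumes p: "p \<in> {0..1}"
    and line_p: "\<And>x. x \<in> {0..1} \<Longrightarrow> \<Phi> x \<le> \<Phi> p + s * (x - p)"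
    and line_1: "\<And>x. x \<in> {0..1} \<Longrightarrow> \<Phi> x \<le> \<Phi> 1 + C * (1 - x)"
    and \<Phi>\<^sub>0: "\<And>x. p < x \<Longrightarrow> x \<le> 1 \<Longrightarrow> \<Phi> x = \<Phi>\<^sub>0 x"
    and cont_\<Phi>\<^sub>0: "continuous_on {p..1} \<Phi>\<^sub>0"
begin

abbreviation "H \<equiv> concave_hull \<Phi>"
abbreviation "D \<equiv> one_sided_deriv H"

lemma bounded: "x \<in> {0..1} \<Longrightarrow> \<Phi> x \<le> \<Phi> 1 + \<bar>C\<bar>"
  using line_1[of x] abs_le_D1[of "C * (1 - x)" "\<bar>C\<bar>"] mult_left_le[of "\<bar>1 - x\<bar>" "\<bar>C\<bar>"]
  by (auto simp: abs_mult)

lemma H_ge: "x \<in> {0..1} \<Longrightarrow> \<Phi> x \<le> H x"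
  using concave_hull_upper bounded by blast

lemma H_concave: "concave_on {0..1} H"
  using concave_on_concave_hull bounded by blast

lemma H_p: "H p = \<Phi> p"
  using concave_hull_le_line[of \<Phi> "\<Phi> p" s p p] line_p H_ge[of p] p by auto

lemma H_1: "H 1 = \<Phi> 1"
  using concave_hull_le_line[of \<Phi> "\<Phi> 1" "- C" 1 1] line_1 H_ge[of 1] by (auto simp: algebra_simps)

lemma H_le_line_p: "x \<in> {0..1} \<Longrightarrow> H x \<le> \<Phi> p + s * (x - p)"
  using concave_hull_le_line line_p by blast

lemma H_le_line_1: "x \<in> {0..1} \<Longrightarrow> H x \<le> \<Phi> 1 + C * (1 - x)"
  using concave_hull_le_line[of \<Phi> "\<Phi> 1" "- C" 1 x] line_1 by (auto simp: algebra_simps)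

lemma D_right:
  assumes u: "p \<le> u" "u < 1"
  shows "D u = (SUP w\<in>{u<..1}. (H w - H u) / (w - u))"
    and "bdd_above ((\<lambda>w. (H w - H u) / (w - u)) ` {u<..1})"
proof -
  have "\<exists>B. \<forall>w. u < w \<longrightarrow> w \<le> 1 \<longrightarrow> H w - H u \<le> B * (w - u)"
  proof (cases "u = p")
    case True
    then show ?thesis using H_le_line_p H_p p by (intro exI[of _ s]) (auto simp: algebra_simps)
  next
    case False
    \<comment> \<open>To the right of u no slope exceeds that of the chord from p to u.\<close>
    have "H w - H u \<le> (H u - H p) / (u - p) * (w - u)" if "u < w" "w \<le> 1" for w
      using concave_three_points[OF H_concave, of p u w] that u p False
      by (simp add: divide_simps) (simp add: algebra_simps)
    then show ?thesis by blast
  qed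
  then obtain B where B: "\<And>w. u < w \<Longrightarrow> w \<le> 1 \<Longrightarrow> H w - H u \<le> B * (w - u)" by blast
  have "0 \<le> u" using u p by auto
  from one_sided_deriv_right[OF H_concave this u(2) B]
  show "D u = (SUP w\<in>{u<..1}. (H w - H u) / (w - u))"
    and "bdd_above ((\<lambda>w. (H w - H u) / (w - u)) ` {u<..1})" by auto
qed

lemma D_1:
  "D 1 = (INF w\<in>{0..<1}. (H 1 - H w) / (1 - w))"
  "bdd_below ((\<lambda>w. (H 1 - H w) / (1 - w)) ` {0..<1})"
  using one_sided_deriv_1[OF H_concave, of C] H_le_line_1 H_1 by auto

text \<open>Together with \<open>D_lower\<close> this brackets each chord slope between the
  derivatives at its ends, the form in which the derivative enters the integration of the ironed
  virtual type.\<close>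

lemma D_upper: "p \<le> u \<Longrightarrow> u < w \<Longrightarrow> w \<le> 1 \<Longrightarrow> H w - H u \<le> D u * (w - u)"
  using cSUP_upper[OF _ D_right(2), of w u] D_right(1)[of u] by (simp add: divide_le_eq)

lemma D_lower:
  assumes "p \<le> u" "u < w" "w \<le> 1"
  shows "D w * (w - u) \<le> H w - H u"
proof (cases "w < 1")
  case True
  have "(SUP y\<in>{w<..1}. (H y - H w) / (y - w)) \<le> (H w - H u) / (w - u)"
  proof (rule cSUP_least)
    fix y assume "y \<in> {w<..1}"
    then show "(H y - H w) / (y - w) \<le> (H w - H u) / (w - u)"
      using concave_three_points[OF H_concave, of u w y] assms p
      by (simp add: divide_simps) (simp add: algebra_simps)
  qed (use True in simp)
  then show ?thesis using D_right(1)[of w] assms True by (simp add: le_divide_eq)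
next
  case False
  then have [simp]: "w = 1" using assms by simp
  have "(INF w\<in>{0..<1}. (H 1 - H w) / (1 - w)) \<le> (H 1 - H u) / (1 - u)"
    using assms p by (intro cINF_lower[OF D_1(2)]) auto
  then show ?thesis using D_1(1) assms by (simp add: le_divide_eq)
qed

lemma D_antimono:
  assumes "p \<le> u" "u \<le> w" "w \<le> 1"
  shows "D w \<le> D u"
proof (cases "u = w")
  case False
  then have "D w * (w - u) \<le> D u * (w - u)"
    using D_upper[of u w] D_lower[of u w] assms by linarith
  then show ?thesis using False assms by (simp add: mult_le_cancel_right)
qed simp

lemma D_le:
  assumes u: "p \<le> u" "u < v" "v \<le> 1"
    and le: "\<And>x. u < x \<Longrightarrow> x < v \<Longrightarrow> H x - H u \<le> m * (x - u)"
  shows "D u \<le> m"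
proof -
  have "u < 1" using u by simp
  have "(SUP w\<in>{u<..1}. (H w - H u) / (w - u)) \<le> m"
  proof (rule cSUP_least)
    fix w assume w: "w \<in> {u<..1}"
    \<comment> \<open>Slopes from u do not fall when the right end moves towards u, so w may be
      replaced by a point before v, where \<open>le\<close> applies.\<close>
    define x where "x = min w ((u + v) / 2)"
    have x: "u < x" "x < v" "x \<le> w" using w u by (auto simp: x_def min_less_iff_disj)
    have "(H w - H u) / (w - u) \<le> (H x - H u) / (x - u)"
      using concave_three_points[OF H_concave, of u x w] x w u p
      by (simp add: divide_simps) (simp add: algebra_simps)
    also have "\<dots> \<le> m" using le[of x] x by (simp add: divide_le_eq)
    finally show "(H w - H u) / (w - u) \<le> m" .
  qed (use u in simp)
  then show ?thesis using D_right(1)[OF u(1) \<open>u < 1\<close>] by simp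
qed

lemma D_1_le:
  assumes "0 \<le> w" "w < 1" "H 1 - H w \<le> m * (1 - w)"
  shows "D 1 \<le> m"
proof -
  have "D 1 \<le> (H 1 - H w) / (1 - w)"
    using assms cINF_lower[OF D_1(2), of w] D_1(1) by simp
  also have "\<dots> \<le> m" using assms by (simp add: divide_le_eq)
  finally show ?thesis .
qed

text \<open>Chord slopes on \<open>{p..1}\<close> lie between \<open>D 1\<close> and
  \<open>D p\<close>, so the hull is Lipschitz up to both ends, where a concave function could
  otherwise jump.\<close>

lemma continuous_H: "continuous_on {p..1} H"
proof -
  define L where "L = \<bar>D p\<bar> + \<bar>D 1\<bar>"
  have L: "\<bar>H w - H u\<bar> \<le> L * (w - u)" if "p \<le> u" "u < w" "w \<le> 1" for u w
  proof -
    have "D 1 * (w - u) \<le> D w * (w - u)" "D u * (w - u) \<le> D p * (w - u)"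
      using that p by (intro mult_right_mono D_antimono; simp)+
    then have "D 1 * (w - u) \<le> H w - H u" "H w - H u \<le> D p * (w - u)"
      using D_upper[OF that] D_lower[OF that] by linarith+
    moreover have "- L * (w - u) \<le> D 1 * (w - u)" "D p * (w - u) \<le> L * (w - u)"
      using that by (auto intro!: mult_right_mono simp: L_def)
    ultimately show ?thesis by auto
  qed
  have "dist (H x) (H y) \<le> L * dist x y" if "x \<in> {p..1}" "y \<in> {p..1}" for x y
    using L[of x y] L[of y x] that by (cases x y rule: linorder_cases) (auto simp: dist_real_def)
  then have "L-lipschitz_on {p..1} H" by (intro lipschitz_onI) (auto simp: L_def)
  then show ?thesis by (rule lipschitz_on_continuous_on)
qed

text \<open>Strictly above \<open>\<Phi>\<close> the hull is affine: a short chord of the hull still dominates \<open>\<Phi>\<close>,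
  hence dominates the hull.\<close>

lemma D_locally_constant:
  assumes z: "p \<le> z" "z < 1" and gap: "\<Phi>\<^sub>0 z < H z"
  obtains d where "0 < d" "\<And>y. p \<le> y \<Longrightarrow> y \<le> 1 \<Longrightarrow> \<bar>y - z\<bar> < d \<Longrightarrow> D y = D z"
proof -
  \<comment> \<open>A third of the gap for the oscillation of the hull, a third for that of
    \<open>\<Phi>\<^sub>0\<close>, and one to spare.\<close>
  define e where "e = (H z - \<Phi>\<^sub>0 z) / 3"
  have e: "0 < e" using gap by (simp add: e_def)
  obtain d1 where d1: "0 < d1" "\<And>u w. p \<le> u \<Longrightarrow> u \<le> 1 \<Longrightarrow> p \<le> w \<Longrightarrow> w \<le> 1 \<Longrightarrow> \<bar>w - u\<bar> < d1 \<Longrightarrow>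
      \<bar>H w - H u\<bar> < e" using uniform_modulus[OF continuous_H e] by metis
  obtain d2 where d2: "0 < d2" "\<And>u w. p \<le> u \<Longrightarrow> u \<le> 1 \<Longrightarrow> p \<le> w \<Longrightarrow> w \<le> 1 \<Longrightarrow> \<bar>w - u\<bar> < d2 \<Longrightarrow>
      \<bar>\<Phi>\<^sub>0 w - \<Phi>\<^sub>0 u\<bar> < e" using uniform_modulus[OF cont_\<Phi>\<^sub>0 e] by metis
  define d where "d = min d1 d2 / 2"
  have d: "0 < d" "d < d1" "d < d2" using d1(1) d2(1) by (auto simp: d_def)
  \<comment> \<open>The chord is cut off at p and 1. For z = p it starts at z itself, which suffices
    because \<open>D\<close> looks to the right.\<close>
  define za zb where "za = max p (z - d)" and "zb = min 1 (z + d)"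
  have zab: "p \<le> za" "za \<le> z" "z < zb" "zb \<le> 1" "z - za \<le> d" "zb - z \<le> d" "0 \<le> za"
    using z d p by (auto simp: za_def zb_def)
  define m where "m = (H zb - H za) / (zb - za)"
  define l where "l y = H za + m * (y - za)" for y
  have l_zb: "l zb = H zb" using zab by (simp add: l_def m_def)
  have three: "(w - y) * H x + (y - x) * H w \<le> (w - x) * H y" if "0 \<le> x" "x \<le> y" "y \<le> w" "w \<le> 1" for x y w
    using concave_three_points[OF H_concave that] .
  have l_eq: "(zb - za) * l y = (zb - y) * H za + (y - za) * H zb" for y
  proof -
    have "(zb - za) * m = H zb - H za" using zab by (simp add: m_def)
    then have "(zb - za) * l y = (zb - za) * H za + (H zb - H za) * (y - za)"
      by (simp add: l_def distrib_left flip: mult.assoc)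
    then show ?thesis by (simp add: algebra_simps)
  qed
  have l_dom: "\<Phi> y \<le> l y" if y: "y \<in> {0..1}" for y
  proof -
    \<comment> \<open>Beyond its ends the chord, extended, lies above the concave hull. Between them
      \<open>za < y\<close> keeps y above p, where \<open>\<Phi>\<close> equals
      \<open>\<Phi>\<^sub>0\<close>; at p itself they may differ by the jump.\<close>
    consider "y \<le> za" | "za < y" "y \<le> zb" | "zb < y" by linarith
    then show ?thesis
    proof cases
      case 1
      have "(zb - za) * H y \<le> (zb - za) * l y"
        using three[of y za zb] 1 zab y unfolding l_eq by (auto simp: algebra_simps)
      then show ?thesis using zab H_ge[OF y] by (simp add: mult_le_cancel_left)
    next
      case 2
      have "\<bar>H za - H z\<bar> < e" "\<bar>H zb - H z\<bar> < e" using d1(2)[of z za] d1(2)[of z zb] zab d z by auto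
      then have "(zb - y) * (H z - e) + (y - za) * (H z - e) \<le> (zb - y) * H za + (y - za) * H zb"
        using 2 by (intro add_mono mult_left_mono) auto
      then have "(zb - za) * (H z - e) \<le> (zb - za) * l y" unfolding l_eq by (simp add: algebra_simps)
      then have "H z - e \<le> l y" using zab by (simp add: mult_le_cancel_left)
      moreover have "\<bar>\<Phi>\<^sub>0 y - \<Phi>\<^sub>0 z\<bar> < e" using d2(2)[of z y] 2 zab d z by auto
      moreover have "\<Phi> y = \<Phi>\<^sub>0 y" using \<Phi>\<^sub>0 2 zab by auto
      moreover have "3 * e = H z - \<Phi>\<^sub>0 z" by (simp add: e_def)
      ultimately show ?thesis by linarith
    next
      case 3
      have "(zb - za) * H y \<le> (zb - za) * l y"
        using three[of za zb y] 3 zab y unfolding l_eq by (auto simp: algebra_simps)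
      then show ?thesis using zab H_ge[OF y] by (simp add: mult_le_cancel_left)
    qed
  qed
  have H_eq: "H y = l y" if y: "za \<le> y" "y \<le> zb" for y
  proof (rule antisym)
    show "H y \<le> l y"
      unfolding l_def using y zab l_dom by (intro concave_hull_le_line) (auto simp: l_def)
    have "(zb - za) * l y \<le> (zb - za) * H y"
      using three[of za y zb] y zab unfolding l_eq by auto
    then show "l y \<le> H y" using zab by (simp add: mult_le_cancel_left)
  qed
  have D_eq: "D y = m" if y: "za \<le> y" "y < zb" for y
  proof (rule antisym)
    show "D y \<le> m"
    proof (rule D_le[of y zb])
      show "H x - H y \<le> m * (x - y)" if "y < x" "x < zb" for x
        using H_eq[of x] H_eq[of y] that y by (simp add: l_def algebra_simps)
    qed (use y zab in auto)
    have "m * (zb - y) = H zb - H y" using H_eq[of y] l_zb y by (simp add: l_def algebra_simps)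
    also have "\<dots> \<le> D y * (zb - y)" using D_upper y zab by auto
    finally show "m \<le> D y" using y by (simp add: mult_le_cancel_right)
  qed
  show ?thesis
  proof (rule that)
    \<comment> \<open>The radius stays short of zb, where the slope may already change.\<close>
    show "0 < min d (zb - z)" using d zab by simp
    show "D y = D z" if "p \<le> y" "y \<le> 1" "\<bar>y - z\<bar> < min d (zb - z)" for y
      using D_eq[of y] D_eq[of z] that zab by (auto simp: za_def)
  qed
qed

lemma D_constant:
  assumes uw: "p \<le> u" "u \<le> w" "w < 1" and gap: "\<And>z. z \<in> {u..w} \<Longrightarrow> \<Phi>\<^sub>0 z < H z"
  shows "D u = D w"
proof (rule connected_local_const[of "{u..w}" u w D])
  show "\<forall>a\<in>{u..w}. \<forall>\<^sub>F b in at a within {u..w}. D a = D b"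
  proof
    fix a assume a: "a \<in> {u..w}"
    then obtain d where "0 < d" and d: "\<And>y. p \<le> y \<Longrightarrow> y \<le> 1 \<Longrightarrow> \<bar>y - a\<bar> < d \<Longrightarrow> D y = D a"
      using D_locally_constant[of a] gap uw by auto
    then show "\<forall>\<^sub>F b in at a within {u..w}. D a = D b"
      using uw unfolding eventually_at dist_real_def by (intro exI[of _ d]) force
  qed
qed (use uw in auto)

end

section \<open>The screening problem\<close>

locale screening =
  fixes E :: economy
  assumes valid: "valid_economy E" and weight_mono: "strict_mono_on (types E) (weight E)"
begin

abbreviation "a \<equiv> lo E"
abbreviation "b \<equiv> hi E"
abbreviation "f \<equiv> dens E"
abbreviation "\<omega> \<equiv> weight E"
abbreviation "\<alpha> \<equiv> pweight E"
abbreviation "v \<equiv> val E"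
abbreviation "c \<equiv> cost E"
abbreviation "A \<equiv> cap E"

section \<open>Preferences and demand\<close>

lemma pos: "0 < A" "0 < c" "0 < a" "a < b" "0 < \<alpha>" "0 < b"
  using valid by (auto simp: valid_economy_def)

lemma types_eq: "types E = {a..b}"
  by (simp add: types_def)

lemma v_nonneg: "q \<in> {0..A} \<Longrightarrow> 0 \<le> v q"
  using valid by (auto simp: valid_economy_def)

lemma v_continuous: "continuous_on {0..A} v"
proof -
  obtain v' where "\<forall>x\<in>{0..A}. (v has_real_derivative v' x) (at x within {0..A})"
    using valid unfolding valid_economy_def by blast
  then show ?thesis using DERIV_continuous_on by blast
qed

lemma v_strict_mono:
  assumes "0 \<le> q" "q < r" "r \<le> A"
  shows "v q < v r"
proof -
  obtain v' where der: "\<And>x. x \<in> {0..A} \<Longrightarrow> (v has_real_derivative v' x) (at x within {0..A})"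
    and pos: "\<And>x. x \<in> {0..A} \<Longrightarrow> 0 < v' x"
    using valid unfolding valid_economy_def by blast
  have "\<exists>z\<in>{q<..<r}. v r - v q = v' z * (r - q)"
    using mvt_within[OF der, of q r] assms by simp
  then obtain z where z: "z \<in> {q<..<r}" "v r - v q = v' z * (r - q)" by blast
  have "0 < v' z * (r - q)" using pos[of z] z assms by (intro mult_pos_pos) auto
  then show ?thesis using z by simp
qed

lemma v_le_iff: "q \<in> {0..A} \<Longrightarrow> r \<in> {0..A} \<Longrightarrow> v q \<le> v r \<longleftrightarrow> q \<le> r"
  using v_strict_mono[of q r] v_strict_mono[of r q] by (cases q r rule: linorder_cases) auto

lemma v_midpoint:
  assumes "0 \<le> q" "q < r" "r \<le> A"
  shows "v q + v r < 2 * v ((q + r) / 2)"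
proof -
  obtain v' v'' where "\<forall>x\<in>{0..A}. (v has_real_derivative v' x) (at x within {0..A}) \<and>
      (v' has_real_derivative v'' x) (at x within {0..A}) \<and> 0 < v' x \<and> v'' x < 0"
    using valid unfolding valid_economy_def by blast
  then show ?thesis using assms by (intro strictly_concave_midpoint[of A v v' v'']) auto
qed

abbreviation "d \<equiv> demand E c"

lemma demand_max:
  assumes "0 < x"
  shows "d x \<in> {0..A}" "q \<in> {0..A} \<Longrightarrow> x * v q - c * q \<le> x * v (d x) - c * d x"
proof -
  let ?S = "\<lambda>q. x * v q - c * q"
  have "continuous_on {0..A} ?S" by (intro continuous_intros v_continuous)
  then obtain k where k: "k \<in> {0..A}" "\<And>q. q \<in> {0..A} \<Longrightarrow> ?S q \<le> ?S k"
    using continuous_attains_sup[of "{0..A}" ?S] pos by auto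
  have "d x \<in> {0..A} \<and> (\<forall>q\<in>{0..A}. ?S q \<le> ?S (d x))"
    unfolding demand_def arg_max_on_def
    by (rule arg_maxI[of "\<lambda>q. q \<in> {0..A}" k]) (use k in \<open>auto simp: not_less\<close>)
  then show "d x \<in> {0..A}" "q \<in> {0..A} \<Longrightarrow> ?S q \<le> ?S (d x)" by auto
qed

lemma demand_unique:
  assumes x: "0 < x" and q: "q \<in> {0..A}" and eq: "x * v q - c * q = x * v (d x) - c * d x"
  shows "q = d x"
proof (rule ccontr)
  assume ne: "q \<noteq> d x"
  note dx = demand_max[OF x]
  let ?m = "(q + d x) / 2"
  have "v q + v (d x) < 2 * v ?m"
    using v_midpoint[of q "d x"] v_midpoint[of "d x" q] ne q dx(1)
    by (cases q "d x" rule: linorder_cases) (auto simp: add.commute)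
  then have "x * (v q + v (d x)) < x * (2 * v ?m)" using x by simp
  moreover have "x * v ?m - c * ?m \<le> x * v (d x) - c * d x" using dx q by (intro dx(2)) auto
  then have "x * (2 * v ?m) - c * (q + d x) \<le> 2 * (x * v (d x) - c * d x)" by simp
  ultimately show False using eq by (simp add: algebra_simps)
qed

text \<open>Adding the two revealed preference inequalities cancels the costs.\<close>

lemma demand_mono:
  assumes "0 < x" "x \<le> y"
  shows "d x \<le> d y"
proof (cases "x = y")
  case False
  have y: "0 < y" using assms by simp
  note dx = demand_max[OF assms(1)] and dy = demand_max[OF y]
  have "x * v (d y) - c * d y \<le> x * v (d x) - c * d x" "y * v (d x) - c * d x \<le> y * v (d y) - c * d y"
    using dx dy by auto
  then have "0 \<le> (y - x) * (v (d y) - v (d x))" by (simp add: algebra_simps)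
  then have "v (d x) \<le> v (d y)" using False assms by (simp add: zero_le_mult_iff)
  then show ?thesis using v_le_iff dx(1) dy(1) by simp
qed simp

lemma q_LF_eq: "q_LF E = d"
  by (intro ext) (simp add: q_LF_def demand_def)

lemma U_LF_eq: "0 < \<theta> \<Longrightarrow> U_LF E \<theta> = \<theta> * v (d \<theta>) - c * d \<theta>"
  unfolding U_LF_def using demand_max[of \<theta>] by (intro cSup_eq_maximum) auto

subsection \<open>The type distribution\<close>

abbreviation "g \<equiv> \<lambda>x. indicator (types E) x * f x"

lemma f_pos: "x \<in> {a..b} \<Longrightarrow> 0 < f x"
  using valid by (auto simp: valid_economy_def types_def)

lemma g_measurable [measurable]: "g \<in> borel_measurable borel"
  using valid by (simp add: valid_economy_def set_borel_measurable_def)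

lemma g_nonneg: "0 \<le> g x"
  using f_pos[of x] by (auto simp: types_def indicator_def)

lemma prob: "prob_space (dF E)"
  using valid by (simp add: valid_economy_def)

lemma g_integral: "integrable lborel g" "integral\<^sup>L lborel g = 1"
proof -
  have "emeasure (dF E) (space (dF E)) = 1" using prob by (rule prob_space.emeasure_space_1)
  then have nn: "(\<integral>\<^sup>+x. ennreal (g x) \<partial>lborel) = 1"
    by (simp add: dF_def emeasure_density)
  show 1: "integrable lborel g"
    by (rule integrableI_nonneg) (use nn g_nonneg in auto)
  have "(\<integral>\<^sup>+x. ennreal (g x) \<partial>lborel) = ennreal (integral\<^sup>L lborel g)"
    using 1 g_nonneg by (intro nn_integral_eq_integral) auto
  with nn show "integral\<^sup>L lborel g = 1"
    by (metis ennreal_eq_1)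
qed

lemma f_absolutely_integrable: "f absolutely_integrable_on {a..b}"
proof -
  have "set_integrable lborel {a..b} f"
    using g_integral(1) by (simp add: set_integrable_def types_def)
  then show ?thesis unfolding set_integrable_def by (intro integrable_completion[THEN iffD2]) auto
qed

lemma f_integrable: "f integrable_on {a..b}"
  using f_absolutely_integrable set_lebesgue_integral_eq_integral(1) by blast

text \<open>Passage from integrals against \<open>dF E\<close> to gauge integrals, in which the
  later estimates are made. Borel measurability of \<open>h\<close> allows the density to be pulled
  out; absolute integrability makes the two notions of integral agree.\<close>

lemma LINT_dF:
  assumes sub: "{u..w} \<subseteq> {a..b}" and h: "set_borel_measurable borel {u..w} h"
    and hf: "(\<lambda>x. h x * f x) absolutely_integrable_on {u..w}"
  shows "(LINT s:{u..w}|dF E. h s) = integral {u..w} (\<lambda>s. h s * f s)"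
proof -
  have eq: "g x *\<^sub>R (indicator {u..w} x *\<^sub>R h x) = indicator {u..w} x *\<^sub>R (h x * f x)" for x
    using sub by (auto simp: types_def indicator_def)
  have "(\<lambda>x. g x *\<^sub>R (indicator {u..w} x *\<^sub>R h x)) \<in> borel_measurable lborel"
    using borel_measurable_scaleR[OF g_measurable h[unfolded set_borel_measurable_def]] by simp
  then have meas: "(\<lambda>x. indicator {u..w} x *\<^sub>R (h x * f x)) \<in> borel_measurable lborel"
    unfolding eq .
  have "(LINT s:{u..w}|dF E. h s) = (\<integral>x. g x *\<^sub>R (indicator {u..w} x *\<^sub>R h x) \<partial>lborel)"
    unfolding set_lebesgue_integral_def dF_def using g_nonneg h
    by (intro integral_density) (auto simp: set_borel_measurable_def)
  also have "\<dots> = (LINT x:{u..w}|lborel. h x * f x)"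
    unfolding eq set_lebesgue_integral_def ..
  also have "\<dots> = (LINT x:{u..w}|lebesgue. h x * f x)"
    unfolding set_lebesgue_integral_def using meas by (intro integral_completion[symmetric]) simp
  also have "\<dots> = integral {u..w} (\<lambda>s. h s * f s)"
    using hf by (rule set_lebesgue_integral_eq_integral(2))
  finally show ?thesis .
qed

lemma F_eq: assumes "x \<in> {a..b}" shows "F E x = integral {a..x} f"
proof -
  interpret prob_space "dF E" by (rule prob)
  have sets: "sets (dF E) = sets borel" by (simp add: dF_def)
  have "F E x = (\<integral>s. indicator {..x} s \<partial>dF E)"
    unfolding F_def cdf_def using sets by simp
  also have "\<dots> = (\<integral>s. g s *\<^sub>R indicator {..x} s \<partial>lborel)"
    unfolding dF_def using g_nonneg by (intro integral_density) auto
  also have "\<dots> = (\<integral>s. g s *\<^sub>R (indicator {a..x} s *\<^sub>R 1) \<partial>lborel)"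
    by (intro Bochner_Integration.integral_cong) (auto simp: types_def indicator_def)
  also have "\<dots> = (LINT s:{a..x}|dF E. 1)"
    unfolding set_lebesgue_integral_def dF_def using g_nonneg by (intro integral_density[symmetric]) auto
  also have "\<dots> = integral {a..x} (\<lambda>s. 1 * f s)"
    using assms f_absolutely_integrable
    by (intro LINT_dF) (auto simp: set_borel_measurable_def intro: absolutely_integrable_on_subinterval)
  finally show ?thesis by simp
qed

lemma F_diff:
  assumes "a \<le> u" "u \<le> w" "w \<le> b"
  shows "F E w - F E u = integral {u..w} f"
  using integral_diff_left[OF f_integrable assms] F_eq assms by simp

lemma F_a: "F E a = 0"
  using F_eq[of a] pos by simp

lemma F_b: "F E b = 1"
proof -
  have "set_integrable lborel {a..b} f"
    using g_integral(1) by (simp add: set_integrable_def types_def)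
  then have "(LINT x:{a..b}|lborel. f x) = integral {a..b} f"
    by (rule set_borel_integral_eq_integral(2))
  then show ?thesis using F_eq[of b] pos g_integral(2)
    by (simp add: set_lebesgue_integral_def types_def)
qed

text \<open>The density has no positive lower bound, but a vanishing integral would force it to be
  zero almost everywhere on an interval of positive length.\<close>

lemma F_less:
  assumes "a \<le> u" "u < w" "w \<le> b"
  shows "F E u < F E w"
proof -
  have i: "f integrable_on {u..w}" using f_integrable assms by (auto intro: integrable_subinterval_real)
  have "0 \<le> integral {u..w} f"
    using i assms f_pos by (intro integral_nonneg) (auto intro: less_imp_le)
  moreover have "integral {u..w} f \<noteq> 0"
  proof
    assume "integral {u..w} f = 0"
    moreover have "f absolutely_integrable_on {u..w}"
      using assms by (intro absolutely_integrable_on_subinterval[OF f_absolutely_integrable]) auto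
    ultimately have ae: "AE x in lborel. x \<in> {u..w} \<longrightarrow> f x = 0"
      using assms f_pos by (intro integral_zero_nonneg_AE) (auto intro: less_imp_le)
    have nz: "f x \<noteq> 0" if "x \<in> {u..w}" for x
      using f_pos[of x] that assms by auto
    from ae have "AE x in lborel. x \<notin> {u..w}"
      by eventually_elim (use nz in blast)
    then have "{u..w} \<in> null_sets lborel" by (subst AE_iff_null_sets) auto
    then show False using assms by (simp add: null_sets_def)
  qed
  ultimately show ?thesis using F_diff[of u w] assms by simp
qed

lemma F_le: "a \<le> u \<Longrightarrow> u \<le> w \<Longrightarrow> w \<le> b \<Longrightarrow> F E u \<le> F E w"
  using F_less[of u w] by (cases "u = w") auto

lemma F_range: "x \<in> {a..b} \<Longrightarrow> F E x \<in> {0..1}"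
  using F_le[of a x] F_le[of x b] F_a F_b by auto

lemma F_inj: "inj_on (F E) {a..b}"
proof (rule inj_onI)
  fix x y assume "x \<in> {a..b}" "y \<in> {a..b}" "F E x = F E y"
  then show "x = y" using F_less[of x y] F_less[of y x] by (cases x y rule: linorder_cases) auto
qed

lemma F_continuous: "continuous_on {a..b} (F E)"
  by (rule continuous_on_eq[OF indefinite_integral_continuous_1[OF f_integrable]]) (simp add: F_eq)

lemma F_image: "F E ` {a..b} = {0..1}"
proof
  show "{0..1} \<subseteq> F E ` {a..b}"
  proof
    fix z :: real assume "z \<in> {0..1}"
    then obtain x where "a \<le> x" "x \<le> b" "F E x = z"
      using IVT'[of "F E" a z b] F_a F_b F_continuous pos by auto
    then show "z \<in> F E ` {a..b}" by auto
  qed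
qed (use F_range in auto)

definition "Finv = inv_into {a..b} (F E)"

lemma Finv_F: "x \<in> {a..b} \<Longrightarrow> Finv (F E x) = x"
  using F_inj by (simp add: Finv_def)

lemma Finv: "z \<in> {0..1} \<Longrightarrow> Finv z \<in> {a..b}" "z \<in> {0..1} \<Longrightarrow> F E (Finv z) = z"
  using inv_into_into[of z "F E" "{a..b}"] f_inv_into_f[of z "F E" "{a..b}"] F_image
  by (simp_all add: Finv_def)

lemma Finv_continuous: "continuous_on {0..1} Finv"
  unfolding F_image[symmetric] by (intro continuous_on_inv F_continuous) (auto simp: Finv_F)

subsection \<open>The weight of the upper tail\<close>

lemma \<omega>_continuous: "continuous_on {a..b} \<omega>"
  using valid by (simp add: valid_economy_def types_def)

lemma \<omega>_nonneg: "x \<in> {a..b} \<Longrightarrow> 0 \<le> \<omega> x"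
  using valid by (auto simp: valid_economy_def types_def)

lemma \<omega>_less: "a \<le> x \<Longrightarrow> x < y \<Longrightarrow> y \<le> b \<Longrightarrow> \<omega> x < \<omega> y"
  using weight_mono by (auto simp: strict_mono_on_def types_def)

lemma \<omega>_le: "a \<le> x \<Longrightarrow> x \<le> y \<Longrightarrow> y \<le> b \<Longrightarrow> \<omega> x \<le> \<omega> y"
  using \<omega>_less[of x y] by (cases "x = y") auto

abbreviation "k \<equiv> \<lambda>s. (\<alpha> - \<omega> s) * f s"
definition "G x = integral {x..b} k"

lemma k_absolutely_integrable: "k absolutely_integrable_on {a..b}"
  by (intro absolutely_integrable_continuous_mult f_absolutely_integrable continuous_intros \<omega>_continuous)

lemma k_integrable: "k integrable_on {a..b}"
  using k_absolutely_integrable set_lebesgue_integral_eq_integral(1) by blast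

lemma G_eq:
  assumes "x \<in> {a..b}" shows "(LINT s:{x..b}|dF E. \<alpha> - \<omega> s) = G x"
  unfolding G_def
proof (rule LINT_dF)
  show "set_borel_measurable borel {x..b} (\<lambda>s. \<alpha> - \<omega> s)"
    using assms by (intro set_measurable_continuous_on continuous_intros continuous_on_subset[OF \<omega>_continuous]) auto
qed (use assms in \<open>auto intro: absolutely_integrable_on_subinterval[OF k_absolutely_integrable]\<close>)

lemma G_diff:
  assumes "a \<le> u" "u \<le> w" "w \<le> b"
  shows "G u - G w = integral {u..w} k"
  using integral_diff_right[OF k_integrable assms] by (simp add: G_def)

lemma G_b: "G b = 0"
  by (simp add: G_def)

lemma G_continuous: "continuous_on {a..b} G"
  unfolding G_def[abs_def] by (rule indefinite_integral_continuous_1'[OF k_integrable])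

lemma mean_weight_eq: "mean_weight E = \<alpha> - G a"
proof -
  have "(\<lambda>s. \<omega> s * f s) absolutely_integrable_on {a..b}"
    by (intro absolutely_integrable_continuous_mult f_absolutely_integrable \<omega>_continuous)
  then have 1: "(\<lambda>s. \<omega> s * f s) integrable_on {a..b}" "mean_weight E = integral {a..b} (\<lambda>s. \<omega> s * f s)"
    unfolding mean_weight_def types_eq
    using set_lebesgue_integral_eq_integral(1)
    by (blast, intro LINT_dF) (auto intro!: set_measurable_continuous_on \<omega>_continuous)
  have "G a = integral {a..b} (\<lambda>s. \<alpha> * f s - \<omega> s * f s)"
    by (simp add: G_def left_diff_distrib)
  also have "\<dots> = \<alpha> * integral {a..b} f - integral {a..b} (\<lambda>s. \<omega> s * f s)"
    using f_integrable 1(1) by (subst integral_diff) (auto intro: integrable_on_mult_right)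
  finally show ?thesis using 1(2) F_eq[of b] F_b pos by simp
qed

lemma integral_k_bounds:
  assumes "a \<le> u" "u \<le> w" "w \<le> b"
  shows "(\<alpha> - \<omega> w) * (F E w - F E u) \<le> integral {u..w} k"
    "integral {u..w} k \<le> (\<alpha> - \<omega> u) * (F E w - F E u)"
proof -
  have i: "f integrable_on {u..w}" "k integrable_on {u..w}"
    using f_integrable k_integrable assms by (auto intro: integrable_subinterval_real)
  have "integral {u..w} (\<lambda>s. (\<alpha> - \<omega> w) * f s) \<le> integral {u..w} k"
    using i assms \<omega>_le f_pos
    by (intro integral_le integrable_on_mult_right mult_right_mono) (auto intro: less_imp_le)
  then show "(\<alpha> - \<omega> w) * (F E w - F E u) \<le> integral {u..w} k" using F_diff[OF assms] by simp
  have "integral {u..w} k \<le> integral {u..w} (\<lambda>s. (\<alpha> - \<omega> u) * f s)"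
    using i assms \<omega>_le f_pos
    by (intro integral_le integrable_on_mult_right mult_right_mono) (auto intro: less_imp_le)
  then show "integral {u..w} k \<le> (\<alpha> - \<omega> u) * (F E w - F E u)" using F_diff[OF assms] by simp
qed

definition "\<theta>L = (LEAST \<theta>. \<theta> \<in> types E \<and> (LINT s:{\<theta>..b}|dF E. \<alpha> - \<omega> s) \<le> 0)"
definition "\<mu> = max (mean_weight E - \<alpha>) 0"

text \<open>\<open>LEAST\<close> on the reals is meaningful here because the minimum is attained:
  \<open>G\<close> is continuous, and b qualifies by \<open>G b = 0\<close>.\<close>

lemma \<theta>L:
  shows \<theta>L_range: "\<theta>L \<in> {a..b}" and G_\<theta>L_le: "G \<theta>L \<le> 0"
    and G_pos: "\<And>x. a \<le> x \<Longrightarrow> x < \<theta>L \<Longrightarrow> 0 < G x"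
proof -
  define S where "S = {x \<in> {a..b}. G x \<le> 0}"
  have "closed ({a..b} \<inter> G -` {..0})"
    by (intro continuous_closed_preimage G_continuous) auto
  then have "closed S" by (simp add: S_def vimage_def Int_def)
  have S: "S \<noteq> {}" "bdd_below S" using G_b pos by (auto simp: S_def intro!: exI[of _ b])
  have "Inf S \<in> S" using closed_contains_Inf[OF S \<open>closed S\<close>] .
  moreover have "Inf S \<le> x" if "x \<in> S" for x using that S(2) by (rule cInf_lower)
  ultimately have "\<theta>L = Inf S"
    unfolding \<theta>L_def by (intro Least_equality) (auto simp: S_def types_eq G_eq)
  then show "\<theta>L \<in> {a..b}" "G \<theta>L \<le> 0" using \<open>Inf S \<in> S\<close> by (auto simp: S_def)
  fix x assume "a \<le> x" "x < \<theta>L"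
  moreover have "x \<notin> S" using \<open>x < \<theta>L\<close> \<open>\<theta>L = Inf S\<close> \<open>\<And>x. x \<in> S \<Longrightarrow> Inf S \<le> x\<close>[of x] by auto
  ultimately show "0 < G x" using \<open>\<theta>L \<in> {a..b}\<close>
    by (auto simp: S_def)
qed

lemma G_nonpos_if_weight_gt:
  assumes "x \<in> {a..b}" "\<alpha> \<le> \<omega> x"
  shows "G x \<le> 0"
proof -
  have "G x \<le> (\<alpha> - \<omega> x) * (F E b - F E x)"
    using integral_k_bounds(2)[of x b] assms by (simp add: G_def)
  also have "\<dots> \<le> 0" using F_range[of x] F_b assms by (intro mult_nonpos_nonneg) auto
  finally show ?thesis .
qed

lemma \<omega>_below: "a \<le> x \<Longrightarrow> x < \<theta>L \<Longrightarrow> \<omega> x \<le> \<alpha>"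
  using G_nonpos_if_weight_gt[of x] G_pos[of x] \<theta>L_range by force

text \<open>\<open>G\<close> falls while \<open>\<omega>\<close> is below \<open>\<alpha>\<close>
  and rises afterwards towards \<open>G b = 0\<close>, so a positive value beyond
  \<open>\<theta>L\<close> would make \<open>G \<theta>L\<close> positive too.\<close>

lemma G_nonpos:
  assumes "\<theta>L \<le> y" "y \<le> b"
  shows "G y \<le> 0"
proof (rule ccontr)
  assume "\<not> G y \<le> 0"
  moreover have "\<omega> y < \<alpha>" using G_nonpos_if_weight_gt[of y] calculation assms \<theta>L_range by force
  then have "0 \<le> (\<alpha> - \<omega> y) * (F E y - F E \<theta>L)"
    using F_le[of \<theta>L y] assms \<theta>L_range by (intro mult_nonneg_nonneg) auto
  then have "0 \<le> G \<theta>L - G y"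
    using integral_k_bounds(1)[of \<theta>L y] G_diff[of \<theta>L y] assms \<theta>L_range by auto
  ultimately show False using G_\<theta>L_le by simp
qed

text \<open>If \<open>\<theta>L = a\<close>, this is the definition of \<open>\<mu>\<close>.
  Otherwise both sides vanish: \<open>G\<close> reaches \<open>\<theta>L\<close> continuously from
  positive values, and \<open>G a > 0\<close> puts the mean weight below
  \<open>\<alpha>\<close>.\<close>

lemma \<mu>_eq: "\<mu> = - G \<theta>L"
proof (cases "\<theta>L = a")
  case True
  then show ?thesis using G_\<theta>L_le by (simp add: \<mu>_def mean_weight_eq)
next
  case False
  then have lt: "a < \<theta>L" using \<theta>L_range by auto
  have "0 \<le> G \<theta>L"
  proof (rule ccontr)
    assume "\<not> 0 \<le> G \<theta>L"
    \<comment> \<open>Were \<open>G \<theta>L\<close> negative, half its value would be attained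
      before \<open>\<theta>L\<close>, where \<open>G\<close> is positive.\<close>
    then obtain x where "a \<le> x" "x \<le> \<theta>L" "G x = G \<theta>L / 2"
      using IVT2'[of G \<theta>L "G \<theta>L / 2" a] G_pos[of a] lt continuous_on_subset[OF G_continuous, of "{a..\<theta>L}"]
        \<theta>L_range by auto
    with G_pos[of x] \<open>\<not> 0 \<le> G \<theta>L\<close> show False by (cases "x = \<theta>L") auto
  qed
  with G_\<theta>L_le have "G \<theta>L = 0" by simp
  moreover have "0 < G a" using G_pos[of a] lt by simp
  ultimately show ?thesis by (simp add: \<mu>_def mean_weight_eq)
qed

lemma \<mu>_nonneg: "0 \<le> \<mu>" by (simp add: \<mu>_def)

lemma \<mu>_pos: "0 < \<mu> \<Longrightarrow> \<theta>L = a"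
  using G_pos[of a] \<theta>L_range by (cases "\<theta>L = a") (auto simp: \<mu>_def mean_weight_eq)

subsection \<open>Ironing the virtual type\<close>

text \<open>The ordinary part of the virtual type times the density, so that the quotient by
  \<open>f\<close> cancels.\<close>

definition "Jd s = s * f s - G s / \<alpha>"

lemma Jd_absolutely_integrable: "Jd absolutely_integrable_on {a..b}"
proof -
  have "(\<lambda>s. s * f s) absolutely_integrable_on {a..b}"
    by (intro absolutely_integrable_continuous_mult f_absolutely_integrable continuous_intros)
  moreover have "(\<lambda>s. G s / \<alpha>) absolutely_integrable_on {a..b}"
    using pos by (intro absolutely_integrable_continuous_real continuous_intros G_continuous) auto
  ultimately show ?thesis unfolding Jd_def[abs_def] by (rule set_integral_diff(1))
qed

lemma Jd_integrable: "a \<le> u \<Longrightarrow> w \<le> b \<Longrightarrow> Jd integrable_on {u..w}"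
  using set_lebesgue_integral_eq_integral(1)[OF Jd_absolutely_integrable]
  by (rule integrable_subinterval_real) auto

lemma f_integrable_sub: "a \<le> u \<Longrightarrow> w \<le> b \<Longrightarrow> f integrable_on {u..w}"
  using f_integrable by (auto intro: integrable_subinterval_real)

abbreviation "m \<equiv> \<mu> * a / \<alpha>"

lemma m_nonneg: "0 \<le> m"
  using \<mu>_nonneg pos by simp

lemma J_times_f: "s \<in> {a..b} \<Longrightarrow> fst (J E \<nu>) s * f s = Jd s"
  using f_pos[of s] pos by (simp add: J_def Jd_def G_eq field_simps)

lemma tail_integral_F:
  assumes x: "x \<in> {a..b}"
  shows "tail_integral E (J E \<mu>) (F E x) = integral {x..b} Jd + (if x = a then m else 0)"
proof -
  have "(LINT s:{x..b}|dF E. fst (J E \<mu>) s) = integral {x..b} (\<lambda>s. fst (J E \<mu>) s * f s)"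
  proof (rule LINT_dF)
    have [measurable]: "(\<lambda>s. indicator {x..b} s * G s) \<in> borel_measurable borel"
      using borel_measurable_continuous_on_indicator[of "{x..b}" G]
        continuous_on_subset[OF G_continuous, of "{x..b}"] x by simp
    \<comment> \<open>Written with \<open>g\<close> and a masked \<open>G\<close>, whose
      measurability is known. Off the interval the numerator is zero, so the division is
      harmless.\<close>
    have "(\<lambda>s. indicator {x..b} s * s - (indicator {x..b} s * G s) / (\<alpha> * g s)) \<in> borel_measurable borel"
      by measurable
    moreover have "(\<lambda>s. indicator {x..b} s *\<^sub>R fst (J E \<mu>) s) =
        (\<lambda>s. indicator {x..b} s * s - (indicator {x..b} s * G s) / (\<alpha> * g s))"
      using x by (auto simp: fun_eq_iff J_def G_eq indicator_def types_eq)
    ultimately show "set_borel_measurable borel {x..b} (fst (J E \<mu>))"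
      by (simp add: set_borel_measurable_def)
    have "Jd absolutely_integrable_on {x..b}"
      using x by (intro absolutely_integrable_on_subinterval[OF Jd_absolutely_integrable]) auto
    then show "(\<lambda>s. fst (J E \<mu>) s * f s) absolutely_integrable_on {x..b}"
      by (rule set_integrable_cong[THEN iffD1, rotated -1]) (use x in \<open>auto simp: J_times_f\<close>)
  qed (use x in auto)
  also have "\<dots> = integral {x..b} Jd"
    using x by (intro integral_cong) (auto simp: J_times_f)
  finally have *: "(LINT s:{x..b}|dF E. fst (J E \<mu>) s) = integral {x..b} Jd" .
  have "F E x = 0 \<longleftrightarrow> x = a" using F_less[of a x] F_a x by force
  with * show ?thesis
    using Finv_F[OF x] by (simp add: tail_integral_def types_eq Finv_def J_def)
qed

section \<open>The tail integral over quantiles and its supporting lines\<close>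

definition "\<Phi> = tail_integral E (J E \<mu>)"
definition "\<Phi>\<^sub>0 z = integral {Finv z..b} Jd"

lemma \<Phi>_F: "x \<in> {a..b} \<Longrightarrow> \<Phi> (F E x) = integral {x..b} Jd + (if x = a then m else 0)"
  unfolding \<Phi>_def by (rule tail_integral_F)

lemma \<Phi>\<^sub>0_F: "x \<in> {a..b} \<Longrightarrow> \<Phi>\<^sub>0 (F E x) = integral {x..b} Jd"
  by (simp add: \<Phi>\<^sub>0_def Finv_F)

text \<open>The Dirac mass is zero unless \<open>\<theta>L = a\<close>, so a jump of
  \<open>\<Phi>\<close> can only occur at the pinning point.\<close>

lemma m_jump: "(if \<theta>L = a then m else 0) = m"
  using \<mu>_pos \<mu>_nonneg by (cases "\<mu> = 0") auto

lemma G_nonneg: "a \<le> x \<Longrightarrow> x \<le> \<theta>L \<Longrightarrow> a < \<theta>L \<Longrightarrow> 0 \<le> G x"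
  using G_pos[of x] \<mu>_eq \<mu>_pos \<mu>_nonneg by (cases "x = \<theta>L"; cases "\<mu> = 0") auto

lemma Jd_ge: "\<theta>L \<le> s \<Longrightarrow> s \<le> b \<Longrightarrow> s * f s \<le> Jd s"
  using G_nonpos[of s] pos by (simp add: Jd_def divide_nonpos_pos)

lemma integral_Jd_ge:
  assumes "\<theta>L \<le> u" "u \<le> w" "w \<le> b"
  shows "u * (F E w - F E u) \<le> integral {u..w} Jd"
proof -
  have u: "a \<le> u" using assms \<theta>L_range by simp
  have "integral {u..w} (\<lambda>s. u * f s) \<le> integral {u..w} Jd"
  proof (intro integral_le integrable_on_mult_right f_integrable_sub Jd_integrable)
    fix s assume s: "s \<in> {u..w}"
    then have "u * f s \<le> s * f s" using f_pos[of s] assms u by (intro mult_right_mono) auto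
    also have "\<dots> \<le> Jd s" using s assms by (intro Jd_ge) auto
    finally show "u * f s \<le> Jd s" .
  qed (use assms u in auto)
  then show ?thesis using F_diff[of u w] assms u by simp
qed

lemma integral_Jd_le:
  assumes "a \<le> u" "u \<le> w" "w \<le> \<theta>L"
  shows "integral {u..w} Jd \<le> w * (F E w - F E u)"
proof (cases "u = w")
  case False
  have w: "w \<le> b" using assms \<theta>L_range by simp
  have "integral {u..w} Jd \<le> integral {u..w} (\<lambda>s. w * f s)"
  proof (intro integral_le integrable_on_mult_right f_integrable_sub Jd_integrable)
    fix s assume s: "s \<in> {u..w}"
    then have "0 \<le> G s" using assms False by (intro G_nonneg) auto
    then have "Jd s \<le> s * f s" using pos by (simp add: Jd_def)
    also have "\<dots> \<le> w * f s" using s f_pos[of s] assms w by (intro mult_right_mono) auto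
    finally show "Jd s \<le> w * f s" .
  qed (use assms w in auto)
  then show ?thesis using F_diff[of u w] assms w by simp
qed simp

text \<open>A bound linear in \<open>1 - F E x\<close> keeps the slope of the hull at 1 finite. The
  first b bounds the type; the other term integrates \<open>- G s / \<alpha>\<close>, at most
  \<open>\<omega> b * (1 - F E x) / \<alpha>\<close>, over a length of at most
  \<open>b - a\<close>.\<close>

lemma integral_Jd_tail_le:
  assumes x: "x \<in> {a..b}"
  shows "integral {x..b} Jd \<le> (b + \<omega> b * (b - a) / \<alpha>) * (1 - F E x)"
proof -
  let ?c = "\<omega> b * (1 - F E x) / \<alpha>"
  have wb: "0 \<le> \<omega> b" using \<omega>_nonneg pos by simp
  have c: "0 \<le> ?c" using wb F_range[OF x] pos by simp
  have "integral {x..b} Jd \<le> integral {x..b} (\<lambda>s. b * f s + ?c)"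
  proof (intro integral_le integrable_add integrable_on_mult_right f_integrable_sub Jd_integrable)
    fix s assume s: "s \<in> {x..b}"
    have "(\<alpha> - \<omega> b) * (1 - F E s) \<le> G s"
      using integral_k_bounds(1)[of s b] s x by (simp add: G_def F_b)
    moreover have "- \<omega> b * (1 - F E s) \<le> (\<alpha> - \<omega> b) * (1 - F E s)"
      using F_range[of s] s x pos by (intro mult_right_mono) auto
    moreover have "\<omega> b * (1 - F E s) \<le> \<omega> b * (1 - F E x)"
      using F_le[of x s] s x wb by (intro mult_left_mono) auto
    ultimately have "- G s \<le> \<omega> b * (1 - F E x)" by simp
    then have "- G s / \<alpha> \<le> ?c" using pos by (intro divide_right_mono) auto
    moreover have "s * f s \<le> b * f s" using s x f_pos[of s] by (intro mult_right_mono) auto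
    ultimately show "Jd s \<le> b * f s + ?c" by (simp add: Jd_def)
  qed (use x in auto)
  also have "\<dots> = b * (1 - F E x) + ?c * (b - x)"
    using F_diff[of x b] F_b x f_integrable_sub[of x b]
    by (subst integral_add) (auto intro: integrable_on_mult_right)
  also have "\<dots> \<le> b * (1 - F E x) + ?c * (b - a)"
    using x c by (intro add_left_mono mult_left_mono) auto
  also have "\<dots> = (b + \<omega> b * (b - a) / \<alpha>) * (1 - F E x)"
    by (simp add: algebra_simps)
  finally show ?thesis .
qed

text \<open>The factor is \<open>x - (b - x)\<close>: types above x contribute at least x, while
  \<open>G s / \<alpha>\<close>, at most \<open>1 - F E x\<close>, costs that much times the length
  \<open>b - x\<close>. It tends to b as x does.\<close>

lemma integral_Jd_tail_ge:
  assumes x: "x \<in> {a..b}"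
  shows "(2 * x - b) * (1 - F E x) \<le> integral {x..b} Jd"
proof -
  let ?c = "1 - F E x"
  have "(2 * x - b) * ?c = x * (1 - F E x) - ?c * (b - x)" by (simp add: algebra_simps)
  also have "\<dots> = integral {x..b} (\<lambda>s. x * f s - ?c)"
    using F_diff[of x b] F_b x f_integrable_sub[of x b]
    by (subst integral_diff) (auto intro: integrable_on_mult_right)
  also have "\<dots> \<le> integral {x..b} Jd"
  proof (intro integral_le integrable_diff integrable_on_mult_right f_integrable_sub Jd_integrable)
    fix s assume s: "s \<in> {x..b}"
    have "G s \<le> (\<alpha> - \<omega> s) * (1 - F E s)"
      using integral_k_bounds(2)[of s b] s x by (simp add: G_def F_b)
    also have "\<dots> \<le> \<alpha> * (1 - F E s)"
      using F_range[of s] s x \<omega>_nonneg[of s] by (intro mult_right_mono) auto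
    also have "\<dots> \<le> \<alpha> * ?c" using F_le[of x s] s x pos by (intro mult_left_mono) auto
    finally have "G s / \<alpha> \<le> ?c" using pos by (simp add: divide_le_eq mult.commute)
    moreover have "x * f s \<le> s * f s" using s x f_pos[of s] by (intro mult_right_mono) auto
    ultimately show "x * f s - ?c \<le> Jd s" by (simp add: Jd_def)
  qed (use x in auto)
  finally show ?thesis .
qed

text \<open>Since \<open>J s \<le> \<theta>L\<close> below \<open>\<theta>L\<close> and \<open>J s \<ge> \<theta>L\<close> above it, the line of slope \<open>-\<theta>L\<close> through the
  graph of \<open>\<Phi>\<close> at \<open>F \<theta>L\<close> supports \<open>\<Phi>\<close>, so that ironing never pools types across \<open>\<theta>L\<close>.\<close>

sublocale hull: pinned_hull \<Phi> \<Phi>\<^sub>0 "F E \<theta>L" "- \<theta>L" "b + \<omega> b * (b - a) / \<alpha> + m"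
proof
  show "F E \<theta>L \<in> {0..1}" using F_range \<theta>L_range .
  fix z :: real assume z: "z \<in> {0..1}"
  define x where "x = Finv z"
  have x: "x \<in> {a..b}" "F E x = z" using Finv[OF z] by (auto simp: x_def)
  have \<Phi>L: "\<Phi> (F E \<theta>L) = integral {\<theta>L..b} Jd + m"
    using \<Phi>_F[OF \<theta>L_range] m_jump by simp
  show "\<Phi> z \<le> \<Phi> (F E \<theta>L) + - \<theta>L * (z - F E \<theta>L)"
  proof (cases "\<theta>L \<le> x")
    case True
    have "\<theta>L * (F E x - F E \<theta>L) \<le> integral {\<theta>L..x} Jd"
      using integral_Jd_ge[of \<theta>L x] True x by auto
    moreover have "integral {\<theta>L..b} Jd - integral {x..b} Jd = integral {\<theta>L..x} Jd"
      using integral_diff_right[OF Jd_integrable[of a b], of \<theta>L x] True x \<theta>L_range by auto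
    moreover have "(if x = a then m else 0) \<le> m" using m_nonneg by simp
    ultimately show ?thesis using \<Phi>_F[OF x(1)] \<Phi>L x(2) by simp
  next
    case False
    \<comment> \<open>A type below \<open>\<theta>L\<close> excludes \<open>\<theta>L = a\<close>,
      so no Dirac mass can lift \<open>\<Phi>\<close> above the line at quantile 0.\<close>
    then have "\<mu> = 0" using \<mu>_pos \<mu>_nonneg x(1) by (cases "\<mu> = 0") auto
    then have "\<Phi> z = integral {x..b} Jd" "\<Phi> (F E \<theta>L) = integral {\<theta>L..b} Jd"
      using \<Phi>_F[OF x(1)] \<Phi>L x(2) by auto
    moreover have "integral {x..\<theta>L} Jd \<le> \<theta>L * (F E \<theta>L - F E x)"
      using integral_Jd_le[of x \<theta>L] False x by auto
    moreover have "integral {x..b} Jd - integral {\<theta>L..b} Jd = integral {x..\<theta>L} Jd"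
      using integral_diff_right[OF Jd_integrable[of a b], of x \<theta>L] False x \<theta>L_range by auto
    ultimately show ?thesis using x(2) by (simp add: algebra_simps)
  qed
  have "\<Phi> 1 = 0" using \<Phi>_F[of b] pos F_b by simp
  \<comment> \<open>The jump occurs only at z = 0, where \<open>1 - z = 1\<close>; hence the summand
    \<open>m\<close> in the slope.\<close>
  moreover have "(if x = a then m else 0) \<le> m * (1 - z)"
    using mult_nonneg_nonneg[OF m_nonneg, of "1 - z"] x z F_a by (cases "x = a") auto
  ultimately show "\<Phi> z \<le> \<Phi> 1 + (b + \<omega> b * (b - a) / \<alpha> + m) * (1 - z)"
    using integral_Jd_tail_le[OF x(1)] \<Phi>_F[OF x(1)] x(2) by (simp add: distrib_right)
next
  fix z assume z: "F E \<theta>L < z" "z \<le> 1"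
  then have z': "z \<in> {0..1}" using F_range[OF \<theta>L_range] by auto
  have "Finv z \<noteq> a" using Finv(2)[OF z'] z F_a F_range[OF \<theta>L_range] by auto
  then show "\<Phi> z = \<Phi>\<^sub>0 z"
    using \<Phi>_F[of "Finv z"] \<Phi>\<^sub>0_F[of "Finv z"] Finv[OF z'] by simp
next
  have "{F E \<theta>L..1} \<subseteq> {0..1}" using F_range[OF \<theta>L_range] by auto
  then have "continuous_on {F E \<theta>L..1} (\<lambda>z. integral {Finv z..b} Jd)"
    using Finv(1)
    by (intro continuous_on_compose2[OF indefinite_integral_continuous_1'[OF Jd_integrable[of a b]]]
        continuous_on_subset[OF Finv_continuous]) auto
  then show "continuous_on {F E \<theta>L..1} \<Phi>\<^sub>0" by (simp add: \<Phi>\<^sub>0_def[abs_def])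
qed

section \<open>The ironed virtual type\<close>

definition "Jbar = ironed E (J E \<mu>)"

lemma Jbar_eq: "Jbar x = - hull.D (F E x)"
  by (simp add: Jbar_def ironed_def one_sided_deriv_def \<Phi>_def Let_def)

lemma \<Phi>_1: "\<Phi> 1 = 0"
  using \<Phi>_F[of b] pos F_b by simp

lemma Jbar_mono: "mono_on {\<theta>L..b} Jbar"
proof (rule mono_onI)
  fix x y assume "x \<in> {\<theta>L..b}" "y \<in> {\<theta>L..b}" "x \<le> y"
  then show "Jbar x \<le> Jbar y"
    using \<theta>L_range F_le[of \<theta>L x] F_le[of x y] F_le[of y b] F_b unfolding Jbar_eq
    by (auto intro!: hull.D_antimono)
qed

text \<open>As \<open>G\<close> is \<open>O(1 - F)\<close>, the left derivative of \<open>\<Phi>\<close> at 1 is \<open>-b\<close>, however irregular the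
  density is near \<open>b\<close>.\<close>

lemma Jbar_b: "b \<le> Jbar b"
proof (rule ccontr)
  assume "\<not> b \<le> Jbar b"
  \<comment> \<open>Halfway between \<open>(Jbar b + b) / 2\<close>, where \<open>2 * x - b\<close>
    equals \<open>Jbar b\<close>, and b; raised to a if it falls outside the type interval.\<close>
  define x where "x = max a ((Jbar b + 3 * b) / 4)"
  have x: "a \<le> x" "x < b" "Jbar b < 2 * x - b"
    using \<open>\<not> b \<le> Jbar b\<close> pos by (auto simp: x_def field_simps max_def)
  have Fx: "F E x \<in> {0..1}" "F E x < 1" using F_range[of x] F_less[of x b] F_b x by auto
  have "(2 * x - b) * (1 - F E x) \<le> \<Phi> (F E x)"
    using integral_Jd_tail_ge[of x] \<Phi>_F[of x] x m_nonneg by auto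
  also have "\<dots> \<le> hull.H (F E x)" using Fx by (intro hull.H_ge)
  finally have "hull.H 1 - hull.H (F E x) \<le> - (2 * x - b) * (1 - F E x)"
    using hull.H_1 \<Phi>_1 by (simp add: algebra_simps)
  then have "hull.D 1 \<le> - (2 * x - b)" using Fx by (intro hull.D_1_le) auto
  then show False using x(3) by (simp add: Jbar_eq F_b)
qed

text \<open>The hull stays below the supporting line that it touches at
  \<open>F E \<theta>L\<close>. If \<open>\<theta>L = b\<close>, the derivative is a left one, which
  the line bounds from the wrong side, and \<open>Jbar_b\<close> takes over.\<close>

lemma Jbar_\<theta>L: "\<theta>L \<le> Jbar \<theta>L"
proof (cases "\<theta>L = b")
  case False
  then have "F E \<theta>L < 1" using F_less[of \<theta>L b] \<theta>L_range F_b by auto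
  moreover have "hull.H z - hull.H (F E \<theta>L) \<le> - \<theta>L * (z - F E \<theta>L)" if "F E \<theta>L < z" "z < 1" for z
    using hull.H_le_line_p[of z] hull.H_p hull.p that by auto
  ultimately have "hull.D (F E \<theta>L) \<le> - \<theta>L" by (intro hull.D_le[of _ 1]) auto
  then show ?thesis by (simp add: Jbar_eq)
qed (use Jbar_b in simp)

text \<open>\<open>T\<close> is the gap between the hull and \<open>\<Phi>\<close>; it is the multiplier of the monotonicity
  constraint on the allocation.\<close>

definition "K s = Jbar s * f s - Jd s"
definition "T x = integral {x..b} K"

lemma Jbar_f_integrable: "\<theta>L \<le> u \<Longrightarrow> w \<le> b \<Longrightarrow> (\<lambda>s. Jbar s * f s) integrable_on {u..w}"
  using \<theta>L_range by (intro integrable_mono_mult f_integrable_sub mono_on_subset[OF Jbar_mono]) auto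

lemma K_integrable: "\<theta>L \<le> u \<Longrightarrow> w \<le> b \<Longrightarrow> K integrable_on {u..w}"
  using \<theta>L_range unfolding K_def[abs_def]
  by (intro integrable_diff Jbar_f_integrable Jd_integrable) auto

text \<open>Minus the hull, composed with \<open>F E\<close>, is a primitive of
  \<open>Jbar s * f s\<close>: \<open>D_upper\<close> and \<open>D_lower\<close> are the bracketing
  that \<open>mono_mult_has_integral\<close> asks for, kinks included.\<close>

lemma T_eq:
  assumes x: "\<theta>L \<le> x" "x \<le> b"
  shows "T x = hull.H (F E x) - integral {x..b} Jd"
proof -
  have x': "a \<le> x" using x \<theta>L_range by simp
  have "((\<lambda>s. Jbar s * f s) has_integral (- hull.H (F E b) - - hull.H (F E x))) {x..b}"
  proof (rule mono_mult_has_integral)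
    show "mono_on {x..b} Jbar" using x by (intro mono_on_subset[OF Jbar_mono]) auto
    show "f integrable_on {x..b}" using x' by (intro f_integrable_sub) auto
    show "0 \<le> f s" if "s \<in> {x..b}" for s using f_pos[of s] that x' by auto
    fix u w assume uw: "x \<le> u" "u < w" "w \<le> b"
    have Fuw: "F E \<theta>L \<le> F E u" "F E u < F E w" "F E w \<le> 1"
      using uw x x' \<theta>L_range F_le[of \<theta>L u] F_less[of u w] F_range[of w] by auto
    have "integral {u..w} f = F E w - F E u" using F_diff[of u w] uw x' by simp
    then show "Jbar u * integral {u..w} f \<le> - hull.H (F E w) - - hull.H (F E u) \<and>
        - hull.H (F E w) - - hull.H (F E u) \<le> Jbar w * integral {u..w} f"
      using hull.D_upper[OF Fuw] hull.D_lower[OF Fuw] by (simp add: Jbar_eq)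
  qed (use x in auto)
  then have "integral {x..b} (\<lambda>s. Jbar s * f s) = hull.H (F E x)"
    using hull.H_1 \<Phi>_1 F_b by (simp add: has_integral_iff)
  then show ?thesis
    unfolding T_def K_def[abs_def] using x x'
    by (subst integral_diff) (auto intro: Jbar_f_integrable Jd_integrable)
qed

lemma T_gap: "\<theta>L \<le> x \<Longrightarrow> x \<le> b \<Longrightarrow> T x = hull.H (F E x) - \<Phi>\<^sub>0 (F E x)"
  using T_eq \<Phi>\<^sub>0_F \<theta>L_range by simp

lemma T_nonneg:
  assumes "\<theta>L \<le> x" "x \<le> b"
  shows "0 \<le> T x"
proof -
  have x: "x \<in> {a..b}" using assms \<theta>L_range by simp
  have "integral {x..b} Jd \<le> \<Phi> (F E x)" using \<Phi>_F[OF x] m_nonneg by simp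
  also have "\<dots> \<le> hull.H (F E x)" using F_range[OF x] by (rule hull.H_ge)
  finally show ?thesis using T_eq assms by simp
qed

text \<open>The hull is pinned to \<open>\<Phi>\<close>, which includes the Dirac mass, whereas
  \<open>T\<close> subtracts only the ordinary tail integral.\<close>

lemma T_\<theta>L: "T \<theta>L = m"
  using T_eq[of \<theta>L] hull.H_p \<Phi>_F[OF \<theta>L_range] m_jump \<theta>L_range by simp

lemma T_b: "T b = 0"
  by (simp add: T_def)

lemma T_continuous: "continuous_on {\<theta>L..b} T"
  unfolding T_def[abs_def] by (rule indefinite_integral_continuous_1'[OF K_integrable]) auto

lemma Jbar_constant:
  assumes uw: "\<theta>L \<le> u" "u \<le> w" "w < b" and T: "\<And>x. x \<in> {u..w} \<Longrightarrow> T x \<noteq> 0"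
  shows "Jbar u = Jbar w"
proof -
  have r: "a \<le> u" "a \<le> \<theta>L" using uw \<theta>L_range by auto
  have "hull.D (F E u) = hull.D (F E w)"
  proof (rule hull.D_constant)
    fix z assume z: "z \<in> {F E u..F E w}"
    then have z': "z \<in> {0..1}" using F_range[of u] F_range[of w] uw r by auto
    note x = Finv[OF z']
    have "u \<le> Finv z" "Finv z \<le> w"
      using z x F_less[of "Finv z" u] F_less[of w "Finv z"] uw r by (force simp: not_less[symmetric])+
    then have "0 < T (Finv z)" using T[of "Finv z"] T_nonneg[of "Finv z"] uw by auto
    then show "\<Phi>\<^sub>0 z < hull.H z" using T_gap[of "Finv z"] x \<open>u \<le> Finv z\<close> \<open>Finv z \<le> w\<close> uw by auto
  qed (use uw r F_le[of \<theta>L u] F_le[of u w] F_less[of w b] F_b in auto)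
  then show ?thesis by (simp add: Jbar_eq)
qed

text \<open>If \<open>Jbar \<theta> < \<theta>\<close>, then \<open>K < 0\<close> on an interval ending at the first zero of \<open>T\<close> after \<open>\<theta>\<close>,
  so \<open>T\<close> would be negative there.\<close>

lemma Jbar_ge:
  assumes \<theta>: "\<theta>L \<le> \<theta>" "\<theta> \<le> b"
  shows "\<theta> \<le> Jbar \<theta>"
proof (rule ccontr)
  assume "\<not> \<theta> \<le> Jbar \<theta>"
  then have r: "Jbar \<theta> < \<theta>" by simp
  with Jbar_\<theta>L have "\<theta>L < \<theta>" using \<theta> by (cases "\<theta> = \<theta>L") auto
  define S where "S = {x \<in> {\<theta>..b}. T x = 0}"
  have "closed ({\<theta>..b} \<inter> T -` {0})"
    using \<theta> by (intro continuous_closed_preimage continuous_on_subset[OF T_continuous]) auto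
  then have "closed S" by (simp add: S_def vimage_def Int_def)
  have S: "S \<noteq> {}" "bdd_below S" using T_b \<theta> by (auto simp: S_def)
  define e where "e = Inf S"
  have e: "e \<in> S" using closed_contains_Inf[OF S \<open>closed S\<close>] by (simp add: e_def)
  have const: "Jbar s = Jbar \<theta>" if "\<theta> \<le> s" "s < e" for s
  proof -
    have "T x \<noteq> 0" if "x \<in> {\<theta>..s}" for x
    proof
      assume "T x = 0"
      then have "x \<in> S" using that \<open>s < e\<close> e by (auto simp: S_def)
      then have "e \<le> x" using S(2) by (simp add: e_def cInf_lower)
      then show False using that \<open>s < e\<close> by auto
    qed
    then show ?thesis using Jbar_constant[of \<theta> s] that \<theta> e by (auto simp: S_def)
  qed
  \<comment> \<open>Any point strictly between \<open>Jbar \<theta>\<close> and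
    \<open>\<theta>\<close>, and not below \<open>\<theta>L\<close>: from y up to e the ironed value
    is at most \<open>Jbar \<theta>\<close>, hence below every type there.\<close>
  define y where "y = (max (Jbar \<theta>) \<theta>L + \<theta>) / 2"
  have y: "Jbar \<theta> < y" "\<theta>L \<le> y" "y < \<theta>" using r \<open>\<theta>L < \<theta>\<close> by (auto simp: y_def)
  have le: "Jbar s \<le> Jbar \<theta>" if "y \<le> s" "s < e" for s
    using const[of s] mono_onD[OF Jbar_mono, of s \<theta>] that y \<theta> by (cases "\<theta> \<le> s") auto
  have ye: "y < e" "e \<le> b" "a \<le> y" using y e \<theta>L_range by (auto simp: S_def)
  have "integral {y..e} K \<le> integral {y..e} (\<lambda>s. (Jbar \<theta> - y) * f s)"
  proof (rule integral_le_off_right)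
    show "K integrable_on {y..e}" using y ye by (intro K_integrable) auto
    show "(\<lambda>s. (Jbar \<theta> - y) * f s) integrable_on {y..e}"
      using ye by (intro integrable_on_mult_right f_integrable_sub) auto
    fix s assume s: "y \<le> s" "s < e"
    have "Jbar s * f s \<le> Jbar \<theta> * f s" "y * f s \<le> s * f s"
      using le[of s] s f_pos[of s] ye by (auto intro!: mult_right_mono)
    moreover have "s * f s \<le> Jd s" using s y ye by (intro Jd_ge) auto
    ultimately show "K s \<le> (Jbar \<theta> - y) * f s" by (simp add: K_def left_diff_distrib)
  qed
  also have "\<dots> = (Jbar \<theta> - y) * (F E e - F E y)" using F_diff[of y e] ye by simp
  also have "\<dots> < 0" using y F_less[of y e] ye by (intro mult_neg_pos) auto
  finally have "integral {y..e} K < 0" .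
  moreover have "T y - T e = integral {y..e} K"
    unfolding T_def using ye y by (intro integral_diff_right[OF K_integrable[of \<theta>L b]]) auto
  ultimately show False using T_nonneg[of y] y ye e by (auto simp: S_def)
qed

subsection \<open>The welfare bound\<close>

definition "R \<theta> = (if \<theta>L \<le> \<theta> then Jbar \<theta> else \<theta>)"

lemma R_ge: "\<theta> \<in> {a..b} \<Longrightarrow> \<theta> \<le> R \<theta>"
  using Jbar_ge by (simp add: R_def)

lemma R_pos: "\<theta> \<in> {a..b} \<Longrightarrow> 0 < R \<theta>"
  using R_ge[of \<theta>] pos by auto

text \<open>By \<open>R_ge\<close>, the switch from the type to its ironed virtual type at
  \<open>\<theta>L\<close> can only be an upward jump; this makes the spliced allocation monotone,
  hence implementable.\<close>

lemma R_mono: "mono_on {a..b} R"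
proof (rule mono_onI)
  fix x y assume xy: "x \<in> {a..b}" "y \<in> {a..b}" "x \<le> y"
  then show "R x \<le> R y"
    using mono_onD[OF Jbar_mono, of x y] R_ge[of y] by (auto simp: R_def)
qed

definition "qs \<theta> = d (R \<theta>)"

lemma qs_eq: "(if \<theta>L \<le> \<theta> then q_mu E \<mu> \<theta> else q_LF E \<theta>) = qs \<theta>"
  by (simp add: qs_def R_def q_mu_def Jbar_def q_LF_eq)

lemma qs_range: "\<theta> \<in> {a..b} \<Longrightarrow> qs \<theta> \<in> {0..A}"
  unfolding qs_def by (intro demand_max R_pos)

lemma qs_mono: "mono_on {a..b} qs"
  by (rule mono_onI) (auto simp: qs_def intro!: demand_mono R_pos mono_onD[OF R_mono])

lemma V_mono:
  assumes "\<And>\<theta>. \<theta> \<in> {a..b} \<Longrightarrow> q \<theta> \<in> {0..A}" "mono_on {a..b} q"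
  shows "mono_on {a..b} (\<lambda>\<theta>. v (q \<theta>))"
  using assms v_le_iff by (auto simp: mono_on_def)

lemmas Vs_mono = V_mono[OF qs_range qs_mono]

lemma mono_bounded: "mono_on {a..b} h \<Longrightarrow> bounded (h ` {a..b})" for h :: "real \<Rightarrow> real"
proof -
  assume h: "mono_on {a..b} h"
  have "h ` {a..b} \<subseteq> {h a..h b}" using h pos by (auto simp: mono_on_def)
  then show "bounded (h ` {a..b})" by (rule bounded_subset[rotated]) simp
qed

lemma mono_times_f: "mono_on {a..b} h \<Longrightarrow> (\<lambda>s. h s * f s) absolutely_integrable_on {a..b}"
  by (intro absolutely_integrable_mult_bounded set_borel_measurable_mono_on mono_bounded
      f_absolutely_integrable) auto

lemma absolutely_integrableD: "h absolutely_integrable_on {a..b} \<Longrightarrow> a \<le> u \<Longrightarrow> w \<le> b \<Longrightarrow> h integrable_on {u..w}"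
  for h :: "real \<Rightarrow> real"
  by (rule integrable_subinterval_real[OF set_lebesgue_integral_eq_integral(1)]) auto

section \<open>Consequences of incentive compatibility\<close>

context
  fixes q t U
  assumes feas: "feasible E q t"
  defines "U \<equiv> \<lambda>\<theta>. \<theta> * v (q \<theta>) - t \<theta>"
begin

lemma q_range: "\<theta> \<in> {a..b} \<Longrightarrow> q \<theta> \<in> {0..A}"
  using feas by (auto simp: feasible_def types_eq)

lemma U_steps:
  assumes "a \<le> u" "u \<le> w" "w \<le> b"
  shows "v (q u) * (w - u) \<le> U w - U u" "U w - U u \<le> v (q w) * (w - u)"
proof -
  have "w * v (q u) - t u \<le> w * v (q w) - t w" "u * v (q w) - t w \<le> u * v (q u) - t u"
    using feas assms by (auto simp: feasible_def types_eq)
  then show "v (q u) * (w - u) \<le> U w - U u" "U w - U u \<le> v (q w) * (w - u)"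
    by (auto simp: U_def algebra_simps)
qed

text \<open>Feasibility imposes no measurability; it is supplied by the monotonicity of v(q),
  \<open>q\<close>, \<open>t\<close> and \<open>U\<close>.\<close>

lemma Vq_mono: "mono_on {a..b} (\<lambda>\<theta>. v (q \<theta>))"
proof (rule mono_onI)
  fix u w assume uw: "u \<in> {a..b}" "w \<in> {a..b}" "u \<le> w"
  then have "v (q u) * (w - u) \<le> v (q w) * (w - u)" using U_steps[of u w] by auto
  then show "v (q u) \<le> v (q w)" using uw by (cases "u = w") (auto simp: mult_le_cancel_right)
qed

lemma q_mono: "mono_on {a..b} q"
  using Vq_mono q_range v_le_iff by (auto simp: mono_on_def)

lemma t_mono: "mono_on {a..b} t"
proof (rule mono_onI)
  fix u w assume uw: "u \<in> {a..b}" "w \<in> {a..b}" "u \<le> w"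
  have "0 \<le> u * (v (q w) - v (q u))"
    using uw mono_onD[OF Vq_mono uw] pos by (intro mult_nonneg_nonneg) auto
  then show "t u \<le> t w" using U_steps(2)[of u w] uw by (auto simp: U_def algebra_simps)
qed

text \<open>\<open>mono_mult_has_integral\<close> with constant weight 1; \<open>U_steps\<close> is
  the required bracketing, so differentiability of \<open>U\<close> never enters.\<close>

lemma U_increment:
  assumes "a \<le> u" "u \<le> w" "w \<le> b"
  shows "U w - U u = integral {u..w} (\<lambda>s. v (q s))"
proof -
  have "((\<lambda>s. v (q s) * 1) has_integral U w - U u) {u..w}"
  proof (rule mono_mult_has_integral)
    show "mono_on {u..w} (\<lambda>s. v (q s))" using assms by (intro mono_on_subset[OF Vq_mono]) auto
    show "v (q x) * integral {x..y} (\<lambda>_. 1) \<le> U y - U x \<and> U y - U x \<le> v (q y) * integral {x..y} (\<lambda>_. 1)"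
      if "u \<le> x" "x < y" "y \<le> w" for x y
      using U_steps[of x y] that assms by simp
  qed (use assms in auto)
  then show ?thesis by (simp add: has_integral_iff)
qed

lemma Vq_nonneg: "\<theta> \<in> {a..b} \<Longrightarrow> 0 \<le> v (q \<theta>)"
  using q_range v_nonneg by blast

lemma U_mono: "mono_on {a..b} U"
proof (rule mono_onI)
  fix u w assume uw: "u \<in> {a..b}" "w \<in> {a..b}" "u \<le> w"
  have "0 \<le> v (q u) * (w - u)" using uw Vq_nonneg[of u] by (intro mult_nonneg_nonneg) auto
  then show "U u \<le> U w" using U_steps(1)[of u w] uw by auto
qed

lemma kU_absolutely_integrable: "(\<lambda>s. k s * U s) absolutely_integrable_on {a..b}"
proof -
  have "(\<lambda>s. U s * k s) absolutely_integrable_on {a..b}"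
    by (intro absolutely_integrable_mult_bounded set_borel_measurable_mono_on mono_bounded
        k_absolutely_integrable U_mono) auto
  then show ?thesis by (simp add: mult.commute)
qed

lemma surplus_absolutely_integrable:
  assumes "mono_on {a..b} r"
  shows "(\<lambda>s. (r s * v (q s) - c * q s) * f s) absolutely_integrable_on {a..b}"
proof -
  have "(\<lambda>s. r s * (v (q s) * f s)) absolutely_integrable_on {a..b}"
    using assms by (intro absolutely_integrable_mult_bounded set_borel_measurable_mono_on mono_bounded
        mono_times_f Vq_mono) auto
  moreover have "(\<lambda>s. c * (q s * f s)) absolutely_integrable_on {a..b}"
    by (intro set_integrable_mult_right mono_times_f q_mono)
  ultimately have "(\<lambda>s. r s * (v (q s) * f s) - c * (q s * f s)) absolutely_integrable_on {a..b}"
    by (rule set_integral_diff(1))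
  then show ?thesis by (simp add: algebra_simps)
qed

lemma welfare_eq_integral:
  "welfare E q t = integral {a..b} (\<lambda>s. \<alpha> * ((s * v (q s) - c * q s) * f s) - k s * U s)"
proof -
  let ?h = "\<lambda>s. \<omega> s * (s * v (q s) - t s) + \<alpha> * (t s - c * q s)"
  have hf: "?h s * f s = \<alpha> * ((s * v (q s) - c * q s) * f s) - k s * U s" for s
    by (simp add: U_def algebra_simps)
  have "welfare E q t = integral {a..b} (\<lambda>s. ?h s * f s)"
    unfolding welfare_def types_eq
  proof (rule LINT_dF)
    have meas: "(\<lambda>s. indicator {a..b} s * p s) \<in> borel_measurable borel" if "mono_on {a..b} p" for p :: "real \<Rightarrow> real"
      using set_borel_measurable_mono_on[OF that] by (simp add: set_borel_measurable_def)
    note [measurable] = meas[OF Vq_mono] meas[OF q_mono] meas[OF t_mono]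
    have [measurable]: "(\<lambda>s. indicator {a..b} s * \<omega> s) \<in> borel_measurable borel"
      using borel_measurable_continuous_on_indicator[OF _ \<omega>_continuous] by simp
    have "(\<lambda>s. (indicator {a..b} s * \<omega> s) * (s * (indicator {a..b} s * v (q s)) - indicator {a..b} s * t s)
        + \<alpha> * (indicator {a..b} s * t s - c * (indicator {a..b} s * q s))) \<in> borel_measurable borel"
      by measurable
    moreover have "(\<lambda>s. indicator {a..b} s *\<^sub>R ?h s) =
        (\<lambda>s. (indicator {a..b} s * \<omega> s) * (s * (indicator {a..b} s * v (q s)) - indicator {a..b} s * t s)
        + \<alpha> * (indicator {a..b} s * t s - c * (indicator {a..b} s * q s)))"
      by (auto simp: fun_eq_iff indicator_def)
    ultimately show "set_borel_measurable borel {a..b} ?h"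
      by (simp add: set_borel_measurable_def)
    show "(\<lambda>s. ?h s * f s) absolutely_integrable_on {a..b}"
      unfolding hf
      by (intro set_integral_diff(1) set_integrable_mult_right surplus_absolutely_integrable
          kU_absolutely_integrable) (auto intro: mono_onI)
  qed simp
  then show ?thesis unfolding hf .
qed

text \<open>Integration by parts is applied only above \<open>\<theta>L\<close>; below it utility
  stays explicit because participation will bound it. The boundary term at b vanishes with
  \<open>G b\<close>, and the one at \<open>\<theta>L\<close> carries \<open>- G \<theta>L\<close>,
  which is \<open>\<mu>\<close>.\<close>

lemma welfare_identity:
  "welfare E q t = \<alpha> * integral {a..b} (\<lambda>s. (R s * v (q s) - c * q s) * f s)
     - integral {a..\<theta>L} (\<lambda>s. k s * U s) + \<mu> * U \<theta>L - \<alpha> * integral {\<theta>L..b} (\<lambda>s. v (q s) * K s)"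
proof -
  note tL = \<theta>L_range[simplified]
  let ?S = "\<lambda>r s. (r s * v (q s) - c * q s) * f s"
  have idm: "mono_on {a..b} (\<lambda>s. s)" by (auto intro: mono_onI)
  have Sid: "?S (\<lambda>s. s) integrable_on {u..w}" "?S R integrable_on {u..w}"
    "(\<lambda>s. k s * U s) integrable_on {u..w}" if "a \<le> u" "w \<le> b" for u w
    using surplus_absolutely_integrable[OF idm] surplus_absolutely_integrable[OF R_mono]
      kU_absolutely_integrable that absolutely_integrableD by blast+
  have VK: "(\<lambda>s. v (q s) * K s) integrable_on {\<theta>L..b}"
    using tL by (intro integrable_mono_mult K_integrable mono_on_subset[OF Vq_mono]) auto
  have V_ai: "(\<lambda>s. v (q s)) absolutely_integrable_on {\<theta>L..b}"
  proof -
    have "(\<lambda>s. v (q s) * 1) absolutely_integrable_on {a..b}"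
      by (intro absolutely_integrable_mult_bounded set_borel_measurable_mono_on mono_bounded Vq_mono) auto
    then have "(\<lambda>s. v (q s)) absolutely_integrable_on {a..b}" by simp
    then show ?thesis by (rule absolutely_integrable_on_subinterval) (use tL in auto)
  qed
  have k_ai: "(\<lambda>s. - k s) absolutely_integrable_on {\<theta>L..b}"
  proof -
    have "(\<lambda>s. -1 * k s) absolutely_integrable_on {\<theta>L..b}"
      using tL by (intro set_integrable_mult_right
          absolutely_integrable_on_subinterval[OF k_absolutely_integrable]) auto
    then show ?thesis by (simp only: mult_minus1)
  qed
  have parts: "integral {\<theta>L..b} (\<lambda>s. U s * - k s) = G b * U b - G \<theta>L * U \<theta>L - integral {\<theta>L..b} (\<lambda>s. G s * v (q s))"
  proof (rule integration_by_parts_primitives[OF _ k_ai V_ai])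
    show "G w - G u = integral {u..w} (\<lambda>s. - k s)" if "\<theta>L \<le> u" "u \<le> w" "w \<le> b" for u w
      using G_diff[of u w] that tL integral_neg[of "{u..w}" k] by (simp add: algebra_simps)
    show "U w - U u = integral {u..w} (\<lambda>s. v (q s))" if "\<theta>L \<le> u" "u \<le> w" "w \<le> b" for u w
      using U_increment that tL by auto
  qed (use tL in auto)
  have GV: "(\<lambda>s. G s * v (q s)) integrable_on {\<theta>L..b}"
    using set_lebesgue_integral_eq_integral(1)[OF absolutely_integrable_continuous_mult[OF _ V_ai]]
      continuous_on_subset[OF G_continuous] tL by auto
  have split: "integral {a..b} p = integral {a..\<theta>L} p + integral {\<theta>L..b} p"
    if "p integrable_on {a..b}" for p :: "real \<Rightarrow> real"
    using Henstock_Kurzweil_Integration.integral_combine[OF _ _ that, of \<theta>L] tL by simp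
  have "welfare E q t = \<alpha> * integral {a..b} (?S (\<lambda>s. s)) - integral {a..b} (\<lambda>s. k s * U s)"
    unfolding welfare_eq_integral using Sid[of a b]
    by (subst integral_diff) (auto intro: integrable_on_mult_right)
  moreover have "integral {a..b} (?S (\<lambda>s. s)) = integral {a..\<theta>L} (?S (\<lambda>s. s)) + integral {\<theta>L..b} (?S (\<lambda>s. s))"
    by (intro split Sid) auto
  moreover have "integral {a..b} (?S R) = integral {a..\<theta>L} (?S R) + integral {\<theta>L..b} (?S R)"
    by (intro split Sid) auto
  moreover have "integral {a..b} (\<lambda>s. k s * U s) = integral {a..\<theta>L} (\<lambda>s. k s * U s) + integral {\<theta>L..b} (\<lambda>s. k s * U s)"
    by (intro split Sid) auto
  moreover have "integral {a..\<theta>L} (?S R) = integral {a..\<theta>L} (?S (\<lambda>s. s))"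
    by (rule integral_spike[of "{\<theta>L}"]) (auto simp: R_def)
  moreover have "integral {\<theta>L..b} (\<lambda>s. k s * U s) = - \<mu> * U \<theta>L + integral {\<theta>L..b} (\<lambda>s. G s * v (q s))"
    using parts G_b \<mu>_eq integral_neg[of "{\<theta>L..b}" "\<lambda>s. k s * U s"] by (simp add: mult.commute)
  \<comment> \<open>Above \<open>\<theta>L\<close>, \<open>s * f s - G s / \<alpha>\<close> is
    \<open>Jd s\<close>, that is, \<open>R s * f s - K s\<close>.\<close>
  moreover have "integral {\<theta>L..b} (?S (\<lambda>s. s)) - integral {\<theta>L..b} (\<lambda>s. G s * v (q s)) / \<alpha>
      = integral {\<theta>L..b} (?S R) - integral {\<theta>L..b} (\<lambda>s. v (q s) * K s)"
  proof -
    have "?S (\<lambda>s. s) s - G s * v (q s) / \<alpha> = ?S R s - v (q s) * K s" if "s \<in> {\<theta>L..b}" for s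
      using that by (simp add: R_def K_def Jd_def algebra_simps)
    then have "integral {\<theta>L..b} (\<lambda>s. ?S (\<lambda>s. s) s - G s * v (q s) / \<alpha>)
        = integral {\<theta>L..b} (\<lambda>s. ?S R s - v (q s) * K s)"
      by (rule integral_cong)
    moreover have "(\<lambda>s. G s * v (q s) / \<alpha>) integrable_on {\<theta>L..b}"
      using integrable_on_mult_left[OF GV, of "1 / \<alpha>"] by simp
    ultimately show ?thesis using Sid[of \<theta>L b] VK tL by (simp add: integral_diff)
  qed
  ultimately show ?thesis using pos by (simp add: field_simps)
qed

end

section \<open>Laissez-faire as a mechanism and the upper bound\<close>

lemma demand_eq_surplus: "\<theta> \<in> {a..b} \<Longrightarrow> \<theta> * v (d \<theta>) - c * d \<theta> = U_LF E \<theta>"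
  using U_LF_eq[of \<theta>] pos by auto

text \<open>Selling at cost makes laissez-faire a feasible mechanism, so the envelope formula and
  the integrability results apply to \<open>U_LF\<close>.\<close>

lemma feasible_LF: "feasible E d (\<lambda>\<theta>. c * d \<theta>)"
proof -
  have p: "0 < \<theta>" if "\<theta> \<in> {a..b}" for \<theta> using that pos by auto
  show ?thesis
    using demand_max[OF p] demand_eq_surplus pos unfolding feasible_def types_eq by auto
qed

lemma U_LF_increment:
  assumes "a \<le> u" "u \<le> w" "w \<le> b"
  shows "U_LF E w - U_LF E u = integral {u..w} (\<lambda>s. v (d s))"
  using U_increment[OF feasible_LF assms] assms by (simp add: demand_eq_surplus)

lemma kU_LF_integrable: "a \<le> u \<Longrightarrow> w \<le> b \<Longrightarrow> (\<lambda>s. k s * U_LF E s) integrable_on {u..w}"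
proof -
  assume "a \<le> u" "w \<le> b"
  then have "(\<lambda>s. k s * (s * v (d s) - c * d s)) integrable_on {u..w}"
    by (intro absolutely_integrableD kU_absolutely_integrable[OF feasible_LF])
  then show ?thesis
    by (rule integrable_eq) (use \<open>a \<le> u\<close> \<open>w \<le> b\<close> in \<open>simp add: demand_eq_surplus\<close>)
qed

abbreviation "bound q \<equiv> \<alpha> * integral {a..b} (\<lambda>s. (R s * v (q s) - c * q s) * f s)
   - integral {a..\<theta>L} (\<lambda>s. k s * U_LF E s)"

lemma welfare_le:
  assumes feas: "feasible E q t"
  shows "welfare E q t \<le> bound q"
proof -
  define U where "U \<theta> = \<theta> * v (q \<theta>) - t \<theta>" for \<theta>
  note tL = \<theta>L_range[simplified]
  have "integral {a..\<theta>L} (\<lambda>s. k s * U_LF E s) \<le> integral {a..\<theta>L} (\<lambda>s. k s * U s)"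
  proof (rule integral_le_off_right)
    show "(\<lambda>s. k s * U_LF E s) integrable_on {a..\<theta>L}" using tL by (intro kU_LF_integrable) auto
    show "(\<lambda>s. k s * U s) integrable_on {a..\<theta>L}"
      unfolding U_def using tL by (intro absolutely_integrableD kU_absolutely_integrable[OF feas]) auto
    fix s assume s: "a \<le> s" "s < \<theta>L"
    then have "U_LF E s \<le> U s" using feas tL by (auto simp: feasible_def types_eq U_def)
    moreover have "0 \<le> k s" using \<omega>_below[OF s] f_pos[of s] s tL by (intro mult_nonneg_nonneg) auto
    ultimately show "k s * U_LF E s \<le> k s * U s" by (rule mult_left_mono)
  qed
  moreover have "\<mu> * U \<theta>L \<le> \<mu> * (a * v (q \<theta>L))"
  proof (cases "\<mu> = 0")
    case False
    then have "\<theta>L = a" using \<mu>_pos \<mu>_nonneg by simp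
    moreover have "0 \<le> t a" using feas pos by (auto simp: feasible_def types_eq)
    ultimately show ?thesis using \<mu>_nonneg by (intro mult_left_mono) (auto simp: U_def)
  qed simp
  \<comment> \<open>The tail integral of \<open>K\<close> at \<open>\<theta>L\<close> is
    \<open>m\<close>, and \<open>\<alpha> * m = \<mu> * a\<close>, so this term offsets the
    preceding bound exactly.\<close>
  moreover have "v (q \<theta>L) * m \<le> integral {\<theta>L..b} (\<lambda>s. v (q s) * K s)"
    using integral_mono_mult_ge[of \<theta>L b K "\<lambda>s. v (q s)"] K_integrable[of \<theta>L b] tL
      mono_on_subset[OF Vq_mono[OF feas], of "{\<theta>L..b}"] T_nonneg T_\<theta>L
    by (auto simp: T_def)
  then have "\<mu> * (a * v (q \<theta>L)) \<le> \<alpha> * integral {\<theta>L..b} (\<lambda>s. v (q s) * K s)"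
    using pos by (simp add: field_simps)
  ultimately show ?thesis
    using welfare_identity[OF feas] unfolding U_def by linarith
qed

subsection \<open>The optimal mechanism\<close>

text \<open>Utility by the envelope formula. Its level at a is the participation bound if some types
  lie below \<open>\<theta>L\<close>, and otherwise the utility at zero transfer, the largest
  compatible with a nonnegative one.\<close>

definition "Us \<theta> = (if a < \<theta>L then U_LF E a else a * v (qs a)) + integral {a..\<theta>} (\<lambda>s. v (qs s))"
definition "ts \<theta> = \<theta> * v (qs \<theta>) - Us \<theta>"

lemma Us_increment:
  assumes "a \<le> u" "u \<le> w" "w \<le> b"
  shows "Us w - Us u = integral {u..w} (\<lambda>s. v (qs s))"
proof -
  have "(\<lambda>s. v (qs s)) integrable_on {a..b}" by (rule integrable_on_mono_on[OF Vs_mono])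
  from integral_diff_left[OF this assms] show ?thesis by (simp add: Us_def)
qed

lemma Us_steps:
  assumes "a \<le> u" "u \<le> w" "w \<le> b"
  shows "v (qs u) * (w - u) \<le> Us w - Us u" "Us w - Us u \<le> v (qs w) * (w - u)"
proof -
  have i: "(\<lambda>s. v (qs s)) integrable_on {u..w}"
    using assms by (intro integrable_on_mono_on mono_on_subset[OF Vs_mono]) auto
  have "integral {u..w} (\<lambda>s. v (qs u)) \<le> integral {u..w} (\<lambda>s. v (qs s))"
    using i assms by (intro integral_le) (auto intro: mono_onD[OF Vs_mono])
  then show "v (qs u) * (w - u) \<le> Us w - Us u" using Us_increment[OF assms] assms by (simp add: mult.commute)
  have "integral {u..w} (\<lambda>s. v (qs s)) \<le> integral {u..w} (\<lambda>s. v (qs w))"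
    using i assms by (intro integral_le) (auto intro: mono_onD[OF Vs_mono])
  then show "Us w - Us u \<le> v (qs w) * (w - u)" using Us_increment[OF assms] assms by (simp add: mult.commute)
qed

lemma d_le_qs: "\<theta> \<in> {a..b} \<Longrightarrow> v (d \<theta>) \<le> v (qs \<theta>)"
  using demand_mono[of \<theta> "R \<theta>"] R_ge[of \<theta>] R_pos[of \<theta>] demand_max(1)[of \<theta>] demand_max(1)[of "R \<theta>"] pos
  by (auto simp: qs_def v_le_iff)

lemma Us_a: "U_LF E a \<le> Us a"
proof -
  have "U_LF E a \<le> a * v (d a)"
  proof -
    have "0 \<le> c * d a" using demand_max(1)[of a] pos by simp
    then show ?thesis using demand_eq_surplus[of a] pos by simp
  qed
  also have "\<dots> \<le> a * v (qs a)" using d_le_qs[of a] pos by (intro mult_left_mono) auto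
  finally show ?thesis by (simp add: Us_def)
qed

lemma integrable_v_demand: "a \<le> u \<Longrightarrow> w \<le> b \<Longrightarrow> (\<lambda>s. v (d s)) integrable_on {u..w}"
  by (intro integrable_on_mono_on mono_on_subset[OF Vq_mono[OF feasible_LF]]) auto

lemma Us_ge:
  assumes \<theta>: "\<theta> \<in> {a..b}"
  shows "U_LF E \<theta> \<le> Us \<theta>"
proof -
  have "integral {a..\<theta>} (\<lambda>s. v (d s)) \<le> integral {a..\<theta>} (\<lambda>s. v (qs s))"
  proof (rule integral_le)
    show "(\<lambda>s. v (d s)) integrable_on {a..\<theta>}" using \<theta> by (intro integrable_v_demand) auto
    show "(\<lambda>s. v (qs s)) integrable_on {a..\<theta>}"
      using \<theta> by (intro integrable_on_mono_on mono_on_subset[OF Vs_mono]) auto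
  qed (use \<theta> d_le_qs in auto)
  then show ?thesis using Us_increment[of a \<theta>] U_LF_increment[of a \<theta>] Us_a \<theta> by auto
qed

lemma Us_eq_LF:
  assumes "a < \<theta>L" "\<theta> \<in> {a..\<theta>L}"
  shows "Us \<theta> = U_LF E \<theta>"
proof -
  have "integral {a..\<theta>} (\<lambda>s. v (qs s)) = integral {a..\<theta>} (\<lambda>s. v (d s))"
    by (rule integral_spike[of "{\<theta>L}"]) (use assms in \<open>auto simp: qs_def R_def\<close>)
  then show ?thesis using U_LF_increment[of a \<theta>] assms \<theta>L_range by (simp add: Us_def)
qed

text \<open>Transfers rise with the type, so the lowest one decides; it is the cost of the
  laissez-faire quantity or zero.\<close>

lemma ts_nonneg:
  assumes \<theta>: "\<theta> \<in> {a..b}"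
  shows "0 \<le> ts \<theta>"
proof -
  have "0 \<le> ts a"
  proof (cases "a < \<theta>L")
    case True
    then have "ts a = c * d a"
      using demand_eq_surplus[of a] pos by (simp add: ts_def Us_def qs_def R_def)
    then show ?thesis using demand_max(1)[of a] pos by simp
  qed (simp add: ts_def Us_def)
  moreover have "0 \<le> a * (v (qs \<theta>) - v (qs a))"
    using mono_onD[OF Vs_mono, of a \<theta>] \<theta> pos by (intro mult_nonneg_nonneg) auto
  then have "ts a \<le> ts \<theta>" using Us_steps(2)[of a \<theta>] \<theta> by (auto simp: ts_def algebra_simps)
  ultimately show ?thesis by simp
qed

lemma feasible_star: "feasible E qs ts"
  unfolding feasible_def types_eq
proof (intro conjI ballI)
  fix \<theta> assume \<theta>: "\<theta> \<in> {a..b}"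
  show "qs \<theta> \<in> {0..A}" using qs_range \<theta> .
  show "0 \<le> ts \<theta>" using ts_nonneg \<theta> .
  show "U_LF E \<theta> \<le> \<theta> * v (qs \<theta>) - ts \<theta>" using Us_ge[OF \<theta>] by (simp add: ts_def)
  fix \<theta>' assume \<theta>': "\<theta>' \<in> {a..b}"
  show "\<theta> * v (qs \<theta>') - ts \<theta>' \<le> \<theta> * v (qs \<theta>) - ts \<theta>"
    using Us_steps(1)[of \<theta>' \<theta>] Us_steps(2)[of \<theta> \<theta>'] \<theta> \<theta>'
    by (cases "\<theta> \<le> \<theta>'") (auto simp: ts_def algebra_simps)
qed

lemma welfare_star: "welfare E qs ts = bound qs"
proof -
  note tL = \<theta>L_range[simplified]
  have U: "(\<lambda>\<theta>. \<theta> * v (qs \<theta>) - ts \<theta>) = Us" by (simp add: ts_def)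
  have "integral {a..\<theta>L} (\<lambda>s. k s * Us s) = integral {a..\<theta>L} (\<lambda>s. k s * U_LF E s)"
  proof (cases "a < \<theta>L")
    case True
    then show ?thesis by (intro integral_cong) (auto simp: Us_eq_LF)
  qed (use tL in auto)
  moreover have "\<mu> * Us \<theta>L = \<mu> * (a * v (qs \<theta>L))"
    using \<mu>_pos \<mu>_nonneg by (cases "\<mu> = 0") (auto simp: Us_def)
  moreover have "integral {\<theta>L..b} (\<lambda>s. v (qs s) * K s) = v (qs \<theta>L) * integral {\<theta>L..b} K"
  proof (rule integral_mono_mult_eq)
    show "mono_on {\<theta>L..b} (\<lambda>s. v (qs s))" using tL by (intro mono_on_subset[OF Vs_mono]) auto
    show "K integrable_on {\<theta>L..b}" by (rule K_integrable) auto
    fix u w assume uw: "\<theta>L \<le> u" "u \<le> w" "w \<le> b" "v (qs u) < v (qs w)"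
    show "\<exists>x\<in>{u..w}. integral {x..b} K = 0"
    \<comment> \<open>At w = b the zero of \<open>T\<close> is b itself. Otherwise the quantity can
      differ between u and w only if \<open>Jbar\<close> does, and by \<open>Jbar_constant\<close>
      that takes a zero of \<open>T\<close> in between.\<close>
    proof (cases "w = b")
      case True
      then show ?thesis using uw T_b by (auto simp: T_def intro: bexI[of _ b])
    next
      case False
      have "Jbar u \<noteq> Jbar w" using uw by (auto simp: qs_def R_def)
      then have "\<exists>x\<in>{u..w}. T x = 0" using Jbar_constant[of u w] uw False by fastforce
      then show ?thesis by (simp add: T_def)
    qed
  qed (use tL in auto)
  then have "\<alpha> * integral {\<theta>L..b} (\<lambda>s. v (qs s) * K s) = \<mu> * (a * v (qs \<theta>L))"
    using T_\<theta>L pos by (simp add: T_def)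
  ultimately show ?thesis
    using welfare_identity[OF feasible_star] unfolding U by (simp add: ts_def)
qed

lemma surplus_le:
  assumes "q \<theta> \<in> {0..A}" "\<theta> \<in> {a..b}"
  shows "(R \<theta> * v (q \<theta>) - c * q \<theta>) * f \<theta> \<le> (R \<theta> * v (qs \<theta>) - c * qs \<theta>) * f \<theta>"
  using demand_max(2)[OF R_pos[OF assms(2)] assms(1)] f_pos[OF assms(2)]
  unfolding qs_def by (intro mult_right_mono) auto

lemma bound_le:
  assumes "feasible E q t"
  shows "bound q \<le> bound qs"
proof -
  have "integral {a..b} (\<lambda>s. (R s * v (q s) - c * q s) * f s)
      \<le> integral {a..b} (\<lambda>s. (R s * v (qs s) - c * qs s) * f s)"
  proof (rule integral_le)
    show "(\<lambda>s. (R s * v (q s) - c * q s) * f s) integrable_on {a..b}"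
      using surplus_absolutely_integrable[OF assms R_mono] by (rule absolutely_integrableD) auto
    show "(\<lambda>s. (R s * v (qs s) - c * qs s) * f s) integrable_on {a..b}"
      using surplus_absolutely_integrable[OF feasible_star R_mono] by (rule absolutely_integrableD) auto
  qed (use surplus_le q_range[OF assms] in auto)
  then show ?thesis using pos by (intro diff_right_mono mult_left_mono) auto
qed

lemma optimal_star: "optimal E qs ts"
  unfolding optimal_def welfare_star
  using feasible_star welfare_le bound_le order_trans by blast

text \<open>Optimality squeezes \<open>bound q\<close> to \<open>bound qs\<close>. The pointwise
  loss in virtual surplus is nonnegative with zero integral, so it vanishes almost everywhere, and
  \<open>demand_unique\<close> applies.\<close>

lemma optimal_unique:
  assumes "optimal E q t"
  shows "AE \<theta> in dF E. q \<theta> = qs \<theta>"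
proof -
  have feas: "feasible E q t" and "welfare E qs ts \<le> welfare E q t"
    using assms feasible_star by (auto simp: optimal_def)
  then have "bound qs \<le> bound q" using welfare_le[OF feas] welfare_star by linarith
  then have eq: "bound qs = bound q" using bound_le[OF feas] by linarith
  let ?S = "\<lambda>q s. (R s * v (q s) - c * q s) * f s"
  note ai = surplus_absolutely_integrable[OF feas R_mono] surplus_absolutely_integrable[OF feasible_star R_mono]
  have "AE s in lborel. s \<in> {a..b} \<longrightarrow> ?S qs s - ?S q s = 0"
  proof (rule integral_zero_nonneg_AE)
    show "(\<lambda>s. ?S qs s - ?S q s) absolutely_integrable_on {a..b}"
      using ai by (intro set_integral_diff(1))
    show "0 \<le> ?S qs s - ?S q s" if "s \<in> {a..b}" for s
      using surplus_le[of q s] q_range[OF feas] that by auto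
    have "integral {a..b} (?S q) = integral {a..b} (?S qs)" using eq pos by simp
    then show "integral {a..b} (\<lambda>s. ?S qs s - ?S q s) = 0"
      using ai by (subst integral_diff) (auto intro: absolutely_integrableD)
  qed
  then have "AE s in lborel. s \<in> {a..b} \<longrightarrow> q s = qs s"
  proof eventually_elim
    case (elim s)
    show ?case
    proof
      assume s: "s \<in> {a..b}"
      then have "R s * v (q s) - c * q s = R s * v (d (R s)) - c * d (R s)"
        using elim f_pos[OF s] by (simp add: qs_def flip: left_diff_distrib)
      then show "q s = qs s"
        using demand_unique[OF R_pos[OF s] q_range[OF feas s]] by (simp add: qs_def)
    qed
  qed
  \<comment> \<open>The form that \<open>AE_density\<close> expects; the density of the type law is
    positive only on the type interval.\<close>
  then have "AE s in lborel. 0 < ennreal (g s) \<longrightarrow> q s = qs s"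
    by eventually_elim (auto simp: types_eq indicator_def)
  then show ?thesis unfolding dF_def by (subst AE_density) simp_all
qed

end

theorem theorem3:
  fixes E :: economy
  assumes "valid_economy E"
    and "strict_mono_on (types E) (weight E)"
  shows
    "let \<theta>L = (LEAST \<theta>. \<theta> \<in> types E \<and> (LINT s:{\<theta>..hi E}|dF E. pweight E - weight E s) \<le> 0);
         \<mu>star = max (mean_weight E - pweight E) 0;
         qstar = (\<lambda>\<theta>. if \<theta>L \<le> \<theta> then q_mu E \<mu>star \<theta> else q_LF E \<theta>)
     in (\<exists>t. optimal E qstar t) \<and>
        (\<forall>q t. optimal E q t \<longrightarrow> (AE \<theta> in dF E. q \<theta> = qstar \<theta>))"
proof -
  interpret screening E by standard fact+
  show ?thesis
    unfolding Let_def \<theta>L_def[symmetric] \<mu>_def[symmetric] qs_eq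
    using optimal_star optimal_unique by blast
qed

end
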